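(* Let $n\ge1$ and $p$ be integers, let $1\le s\le S<\frac p2$ be integers, and let $X_1,\dots,X_n$ be i.i.d. centered Gaussian vectors in $\mathbb{R}^p$ with $\Sigma_n=\frac1n\sum_{k=1}^nX_kX_k^T$. For $u>1$ let $$t_{n,p}^{HS+}=\max\left\{\sqrt{\frac{4u\cdot s\log\binom{S}{s}}{n(p-S)}},\;\frac{8u\cdot s\log\binom{S}{s}}{n(p-S)}\right\}$$ and define the test $$\Delta_n^{HS+}=\max_{\mathbf{S}\subseteq\{1,\dots,S\},\ \#\mathbf{S}=s} I\left(\varphi_{A_{\mathbf{S}}}(\Sigma_n-I_p)\ge t_{n,p}^{HS+}\right).$$ Then $$R(\Delta_n^{HS+},\mathcal{F}_+)\le\exp\left(-(u-1)\log\binom{S}{s}\right)+\exp\left(-\frac u4\right),\qquad \mathcal{F}_+=\mathcal{F}_+(s,S,\sigma),$$ provided that $$\sigma\ge\frac1s\left(t_{n,p}^{HS+}+(2s+1)\max\left\{\sqrt{\frac{u\cdot s}{n(p-S)}},\;\frac{2u\cdot s}{n(p-S)}\right\}\right).$$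
   Context: $I(\cdot)$ is the indicator function. $\mathbb{P}_\Sigma$ denotes probability when $X_1,\dots,X_n$ are i.i.d. $\mathcal{N}_p(0,\Sigma)$. For a symmetric $p\times p$ matrix $A$, $\varphi_A(B)=\mathrm{Tr}(AB)$. For $1\le j\le p-1$, $A_j$ is the $p\times p$ matrix with entries $[A_j]_{k\ell}=\frac{1}{2(p-j)}$ if $|k-\ell|=j$ and $0$ otherwise, and for $\mathbf{S}\subseteq\{1,\dots,S\}$, $A_{\mathbf{S}}=\sum_{j\in\mathbf{S}}A_j$. $\mathcal{S}_p^{++}$ is the set of symmetric positive definite $p\times p$ matrices and $\mathcal{T}_p$ the set of $p\times p$ Toeplitz matrices; for $\Sigma\in\mathcal{S}_p^{++}\cap\mathcal{T}_p$ write $\Sigma_{ij}=\sigma_{|i-j|}$. Standing assumption: all covariance matrices satisfy $\sigma_0=1$ (correlation matrices). For a real $\sigma>0$, $\mathcal{F}_+(s,S,\sigma)$ is the set of $\Sigma\in\mathcal{S}_p^{++}\cap\mathcal{T}_p$ (with $\sigma_0=1$) for which there exists $\mathbf{S}\subseteq\{1,\dots,S\}$ with $|\mathbf{S}|=s$ such that $\sigma_j\ge\sigma$ for all $j\in\mathbf{S}$ and $\sigma_j=0$ for all $j\in\{1,\dots,p-1\}\setminus\mathbf{S}$. For a test $\Delta_n$ (a $\{0,1\}$-valued function of the observations) and a class $\mathcal{G}$ of covariance matrices, the maximal testing risk is $R(\Delta_n,\mathcal{G})=\mathbb{P}_{I_p}(\Delta_n=1)+\sup_{\Sigma\in\mathcal{G}}\mathbb{P}_\Sigma(\Delta_n=0)$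 (a supremum over an empty class being $0$). *)

theory Defs
  imports
    "HOL-Probability.Probability"
    "Jordan_Normal_Form.Determinant"
    "Jordan_Normal_Form.Gauss_Jordan_Elimination"
begin

text \<open>Matrix indices run over \<open>0, \<dots>, p - 1\<close>; only differences of indices matter below, so this
  agrees with the usual indexing by \<open>1, \<dots>, p\<close>. A vector of \<open>\<real>\<^sup>p\<close> that is an outcome of a random
  experiment is a function in the product space over \<open>{..<p}\<close>, and \<open>vec p x\<close> is the corresponding
  algebraic vector.\<close>

definition mat_trace :: "real mat \<Rightarrow> real" where
  "mat_trace A = (\<Sum>i<dim_row A. A $$ (i, i))"

definition sym_pos_def :: "nat \<Rightarrow> real mat set" where
  "sym_pos_def p = {A \<in> carrier_mat p p. transpose_mat A = A \<and>
     (\<forall>v \<in> carrier_vec p. v \<noteq> 0\<^sub>v p \<longrightarrow> v \<bullet> (A *\<^sub>v v) > 0)}"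

definition toeplitz :: "nat \<Rightarrow> real mat set" where
  "toeplitz p = {A \<in> carrier_mat p p.
     \<forall>i j. Suc i < p \<longrightarrow> Suc j < p \<longrightarrow> A $$ (Suc i, Suc j) = A $$ (i, j)}"

text \<open>For a symmetric Toeplitz matrix with entries \<open>\<sigma>\<^bsub>|i - j|\<^esub>\<close>, the value \<open>\<sigma>\<^sub>j\<close> is read off
  the first row.\<close>

definition toeplitz_coeff :: "real mat \<Rightarrow> nat \<Rightarrow> real" where
  "toeplitz_coeff \<Sigma> j = \<Sigma> $$ (0, j)"

text \<open>The distribution \<open>N\<^sub>p(0, \<Sigma>)\<close>, for symmetric positive definite \<open>\<Sigma>\<close>, by its Lebesgue density.
  Such a \<open>\<Sigma>\<close> is invertible, so \<open>mat_inverse \<Sigma>\<close> is not \<open>None\<close>.\<close>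

definition gaussian_density :: "nat \<Rightarrow> real mat \<Rightarrow> (nat \<Rightarrow> real) \<Rightarrow> real" where
  "gaussian_density p \<Sigma> x =
     exp (- (vec p x \<bullet> (the (mat_inverse \<Sigma>) *\<^sub>v vec p x)) / 2) /
     sqrt ((2 * pi) ^ p * Determinant.det \<Sigma>)"

definition gaussian :: "nat \<Rightarrow> real mat \<Rightarrow> (nat \<Rightarrow> real) measure" where
  "gaussian p \<Sigma> = density (Pi\<^sub>M {..<p} (\<lambda>_. lborel)) (\<lambda>x. ennreal (gaussian_density p \<Sigma> x))"

text \<open>The law of a sample of \<open>n\<close> independent observations. The \<open>k\<close>-th observation of a sample
  \<open>X\<close> is \<open>X k\<close>, with coordinates \<open>X k i\<close>, where \<open>k < n\<close> and \<open>i < p\<close>.\<close>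

definition sample_law :: "nat \<Rightarrow> nat \<Rightarrow> real mat \<Rightarrow> (nat \<Rightarrow> nat \<Rightarrow> real) measure" where
  "sample_law n p \<Sigma> = Pi\<^sub>M {..<n} (\<lambda>_. gaussian p \<Sigma>)"

definition sample_cov :: "nat \<Rightarrow> nat \<Rightarrow> (nat \<Rightarrow> nat \<Rightarrow> real) \<Rightarrow> real mat" where
  "sample_cov n p X = mat p p (\<lambda>(i, j). (1 / real n) * (\<Sum>k<n. X k i * X k j))"

definition lag_mat :: "nat \<Rightarrow> nat \<Rightarrow> real mat" where
  "lag_mat p j = mat p p (\<lambda>(k, l).
     if \<bar>int k - int l\<bar> = int j then 1 / (2 * (real p - real j)) else 0)"

text \<open>The sum of the matrices \<open>lag_mat p j\<close> over \<open>j \<in> J\<close>, written entrywise because matrices of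
  unspecified dimension do not form a commutative monoid.\<close>

definition lag_set_mat :: "nat \<Rightarrow> nat set \<Rightarrow> real mat" where
  "lag_set_mat p J = mat p p (\<lambda>(k, l). \<Sum>j\<in>J. lag_mat p j $$ (k, l))"

definition lin_functional :: "real mat \<Rightarrow> real mat \<Rightarrow> real" where
  "lin_functional A B = mat_trace (A * B)"

definition supports :: "nat \<Rightarrow> nat \<Rightarrow> nat set set" where
  "supports s S = {J. J \<subseteq> {1..S} \<and> card J = s}"

definition F_plus :: "nat \<Rightarrow> nat \<Rightarrow> nat \<Rightarrow> real \<Rightarrow> real mat set" where
  "F_plus p s S \<sigma> = {\<Sigma> \<in> sym_pos_def p \<inter> toeplitz p. toeplitz_coeff \<Sigma> 0 = 1 \<and>
     (\<exists>J \<in> supports s S. (\<forall>j\<in>J. toeplitz_coeff \<Sigma> j \<ge> \<sigma>) \<and>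
        (\<forall>j \<in> {1..p - 1} - J. toeplitz_coeff \<Sigma> j = 0))}"

text \<open>The maximal testing risk; the supremum over an empty class is \<open>0\<close>.\<close>

definition risk ::
  "nat \<Rightarrow> nat \<Rightarrow> ((nat \<Rightarrow> nat \<Rightarrow> real) \<Rightarrow> nat) \<Rightarrow> real mat set \<Rightarrow> real" where
  "risk n p \<Delta> G =
     measure (sample_law n p (1\<^sub>m p)) {X \<in> space (sample_law n p (1\<^sub>m p)). \<Delta> X = 1} +
     (if G = {} then 0 else
        (SUP \<Sigma>\<in>G. measure (sample_law n p \<Sigma>) {X \<in> space (sample_law n p \<Sigma>). \<Delta> X = 0}))"

definition HS_threshold :: "nat \<Rightarrow> nat \<Rightarrow> nat \<Rightarrow> nat \<Rightarrow> real \<Rightarrow> real" where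
  "HS_threshold n p s S u =
     max (sqrt (4 * u * real s * ln (real (S choose s)) / (real n * (real p - real S))))
         (8 * u * real s * ln (real (S choose s)) / (real n * (real p - real S)))"

definition HS_test ::
  "nat \<Rightarrow> nat \<Rightarrow> nat \<Rightarrow> nat \<Rightarrow> real \<Rightarrow> (nat \<Rightarrow> nat \<Rightarrow> real) \<Rightarrow> nat" where
  "HS_test n p s S u X =
     Max ((\<lambda>J. of_bool (lin_functional (lag_set_mat p J) (sample_cov n p X - 1\<^sub>m p)
                          \<ge> HS_threshold n p s S u)) ` supports s S)"

end

theory Submission
  imports Defs "Jordan_Normal_Form.Schur_Decomposition"
begin

text \<open>If \<open>x\<close> is \<open>N(0, \<Sigma>)\<close> and \<open>A\<close> is symmetric, then \<open>x\<^sup>T A x\<close> has moment generating function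
  \<open>\<lambda> \<mapsto> det (I - 2 \<lambda> A \<Sigma>)\<close> to the power \<open>- 1 / 2\<close>. The eigenvalues of \<open>A \<Sigma>\<close> are real, so
  \<open>1 - x \<ge> exp (- x - x\<^sup>2)\<close> for \<open>\<bar>x\<bar> \<le> 1 / 2\<close>, applied to each of them, bounds the centred moment
  generating function by \<open>exp (2 \<lambda>\<^sup>2 tr ((A \<Sigma>)\<^sup>2))\<close> for small \<open>\<lambda>\<close>, and Chernoff's method gives a
  Bernstein inequality. For \<open>A\<close> the matrix of a support of size \<open>s\<close>, the maximal absolute row sum is at most
  \<open>a = s / (p - S)\<close>, the squared Frobenius norm is at most \<open>a / 2\<close>, and the row sums of \<open>\<Sigma>\<close> are
  at most \<open>1\<close> under the null hypothesis and \<open>2 s + 1\<close> on the alternative. The first error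
  follows by a union bound over the supports; for the second one only the true support is used,
  for which the statistic has expectation at least \<open>s \<sigma>\<close>.\<close>

subsection \<open>A lower bound for determinants\<close>

text \<open>The function \<open>f\<close> vanishes at 0, and its derivative y (1 - 2 y) / (1 - y)
  has the sign of y for |y| \<le> 1 / 2, so 0 is its minimum there. The quadratic term in the
  exponent is what later produces the trace of the squared matrix.\<close>

lemma exp_le_one_minus:
  fixes x :: real
  assumes "\<bar>x\<bar> \<le> 1 / 2"
  shows "exp (- x - x\<^sup>2) \<le> 1 - x"
proof -
  define f where "f = (\<lambda>x::real. ln (1 - x) + x + x\<^sup>2)"
  have deriv: "(f has_real_derivative (y * (1 - 2 * y) / (1 - y))) (at y)" if "\<bar>y\<bar> \<le> 1 / 2" for y
  proof -
    have "1 - y > 0" using that by auto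
    then show ?thesis unfolding f_def
      by (auto intro!: derivative_eq_intros simp: field_simps power2_eq_square)
  qed
  have f0: "f 0 = 0" by (simp add: f_def)
  have "f x \<ge> 0"
  proof (cases "x \<ge> 0")
    case True
    have "f 0 \<le> f x"
    proof (rule DERIV_nonneg_imp_nondecreasing[OF True])
      fix y assume y: "0 \<le> y" "y \<le> x"
      with assms have "y * (1 - 2 * y) / (1 - y) \<ge> 0" by auto
      with y assms deriv[of y] show "\<exists>d. (f has_real_derivative d) (at y) \<and> d \<ge> 0" by auto
    qed
    with f0 show ?thesis by simp
  next
    case False
    have "f x \<ge> f 0"
    proof (rule DERIV_nonpos_imp_nonincreasing[where f = f and a = x and b = 0])
      fix y assume y: "x \<le> y" "y \<le> 0"
      with assms have "y * (1 - 2 * y) / (1 - y) \<le> 0"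
        by (auto simp: divide_nonpos_pos mult_nonpos_nonneg)
      with y assms deriv[of y] show "\<exists>d. (f has_real_derivative d) (at y) \<and> d \<le> 0" by auto
    qed (use False in auto)
    with f0 show ?thesis by simp
  qed
  then have "- x - x\<^sup>2 \<le> ln (1 - x)" by (simp add: f_def)
  then have "exp (- x - x\<^sup>2) \<le> exp (ln (1 - x))" by simp
  also have "\<dots> = 1 - x" using assms by auto
  finally show ?thesis .
qed

text \<open>Cyclicity of the trace. It is stated for explicit diagonal sums because
  \<open>mat_trace\<close> is real, whereas the triangular form used below is complex.\<close>

lemma sum_diag_mult_commute:
  fixes A B :: "'a::comm_semiring_0 mat"
  assumes "A \<in> carrier_mat n m" "B \<in> carrier_mat m n"
  shows "(\<Sum>i<n. (A * B) $$ (i, i)) = (\<Sum>i<m. (B * A) $$ (i, i))"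
proof -
  have "(\<Sum>i<n. (A * B) $$ (i, i)) = (\<Sum>i<n. \<Sum>j<m. A $$ (i, j) * B $$ (j, i))"
    using assms by (intro sum.cong) (auto simp: scalar_prod_def atLeast0LessThan)
  also have "\<dots> = (\<Sum>j<m. \<Sum>i<n. B $$ (j, i) * A $$ (i, j))"
    by (subst sum.swap) (simp add: mult.commute)
  also have "\<dots> = (\<Sum>i<m. (B * A) $$ (i, i))"
    using assms by (intro sum.cong) (auto simp: scalar_prod_def atLeast0LessThan)
  finally show ?thesis .
qed

lemma sum_diag_similar:
  fixes A B :: "'a::comm_semiring_1 mat"
  assumes "similar_mat_wit A B P Q" "A \<in> carrier_mat n n"
  shows "(\<Sum>i<n. A $$ (i, i)) = (\<Sum>i<n. B $$ (i, i))"
proof -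
  note w = similar_mat_witD2[OF assms(2,1)]
  have "(\<Sum>i<n. A $$ (i, i)) = (\<Sum>i<n. (P * (B * Q)) $$ (i, i))"
    using w by (simp add: assoc_mult_mat[of _ n n _ n _ n])
  also have "\<dots> = (\<Sum>i<n. ((B * Q) * P) $$ (i, i))"
    using w by (intro sum_diag_mult_commute) auto
  also have "(B * Q) * P = B"
    using w by (simp add: assoc_mult_mat[of _ n n _ n _ n])
  finally show ?thesis .
qed

text \<open>For j different from i, one of the positions (i, j) and (j, i) lies below the diagonal,
  so only j = i contributes to the sum.\<close>

lemma upper_triangular_square_diag:
  fixes B :: "'a::comm_semiring_1 mat"
  assumes "upper_triangular B" "B \<in> carrier_mat n n" "i < n"
  shows "(B * B) $$ (i, i) = (B $$ (i, i))\<^sup>2"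
proof -
  have "(B * B) $$ (i, i) = (\<Sum>j<n. B $$ (i, j) * B $$ (j, i))"
    using assms by (auto simp: scalar_prod_def atLeast0LessThan)
  also have "\<dots> = (\<Sum>j<n. if j = i then (B $$ (i, i))\<^sup>2 else 0)"
  proof (intro sum.cong refl)
    fix j assume "j \<in> {..<n}"
    then show "B $$ (i, j) * B $$ (j, i) = (if j = i then (B $$ (i, i))\<^sup>2 else 0)"
      using assms upper_triangularD[OF assms(1), of j i] upper_triangularD[OF assms(1), of i j]
      by (cases i j rule: linorder_cases) (auto simp: power2_eq_square)
  qed
  also have "\<dots> = (B $$ (i, i))\<^sup>2" using assms by simp
  finally show ?thesis .
qed

text \<open>The assumption \<open>eigen\<close> is about complex eigenvalues: it is
  \<open>N (x + \<i> y) = (\<alpha> + \<i> \<beta>) (x + \<i> y)\<close> split into real and imaginary parts.\<close>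

lemma det_one_minus_ge:
  fixes N :: "real mat"
  assumes N: "N \<in> carrier_mat n n"
    and eigen: "\<And>\<alpha> \<beta> x y. x \<in> carrier_vec n \<Longrightarrow> y \<in> carrier_vec n \<Longrightarrow> x \<noteq> 0\<^sub>v n \<or> y \<noteq> 0\<^sub>v n \<Longrightarrow>
      N *\<^sub>v x = \<alpha> \<cdot>\<^sub>v x - \<beta> \<cdot>\<^sub>v y \<Longrightarrow> N *\<^sub>v y = \<alpha> \<cdot>\<^sub>v y + \<beta> \<cdot>\<^sub>v x \<Longrightarrow> \<beta> = 0 \<and> \<bar>\<alpha>\<bar> \<le> 1 / 2"
  shows "exp (- mat_trace N - mat_trace (N * N)) \<le> Determinant.det (1\<^sub>m n - N)"
proof -
  \<comment> \<open>Over the complex numbers the characteristic polynomial splits, so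
    \<open>M\<close> is similar to an upper triangular matrix. The two traces and the determinant
    can then be read off its diagonal.\<close>
  define M where "M = map_mat complex_of_real N"
  have M: "M \<in> carrier_mat n n" using N by (simp add: M_def)
  obtain es where es: "char_poly M = (\<Prod>a\<leftarrow>es. [:- a, 1:])"
    using char_poly_factorized[OF M] by blast
  obtain B where B: "B \<in> carrier_mat n n" and tri: "upper_triangular B" and sim: "similar_mat M B"
    using schur_decomposition_exists[OF M es] by blast
  obtain P Q where wit: "similar_mat_wit M B P Q" using sim by (auto simp: similar_mat_def)
  note w = similar_mat_witD2[OF M wit]
  have diag: "\<exists>r. B $$ (i, i) = complex_of_real r \<and> \<bar>r\<bar> \<le> 1 / 2" if i: "i < n" for i
  proof -
    define z where "z = B $$ (i, i)"
    have "char_poly M = char_poly B" by (rule char_poly_similar[OF sim])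
    also have "\<dots> = (\<Prod>a\<leftarrow>diag_mat B. [:- a, 1:])" by (rule char_poly_upper_triangular[OF B tri])
    finally have cp: "char_poly M = (\<Prod>a\<leftarrow>diag_mat B. [:- a, 1:])" .
    have "z \<in> set (diag_mat B)" using i B by (auto simp: diag_mat_def z_def)
    then have "poly (char_poly M) z = 0"
      unfolding cp by (auto simp: poly_prod_list prod_list_zero_iff)
    then have "eigenvalue M z" using eigenvalue_root_char_poly[OF M] by simp
    then obtain v where v: "v \<in> carrier_vec n" "v \<noteq> 0\<^sub>v n" "M *\<^sub>v v = z \<cdot>\<^sub>v v"
      using M by (auto simp: eigenvalue_def eigenvector_def)
    \<comment> \<open>The real and imaginary parts of an eigenvector for \<open>z\<close> satisfy
      the two real equations of \<open>eigen\<close>, with \<alpha> = Re z and \<beta> = Im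
      z.\<close>
    define x where "x = map_vec Re v"
    define y where "y = map_vec Im v"
    have xy: "x \<in> carrier_vec n" "y \<in> carrier_vec n" using v by (auto simp: x_def y_def)
    have "x \<noteq> 0\<^sub>v n \<or> y \<noteq> 0\<^sub>v n"
    proof (rule ccontr)
      assume "\<not> ?thesis"
      then have "x $ j = 0 \<and> y $ j = 0" if "j < n" for j using that by simp
      then have "v $ j = 0" if "j < n" for j
        using that v by (auto simp: x_def y_def complex_eq_iff)
      with v show False by auto
    qed
    moreover have comp: "(\<Sum>k<n. complex_of_real (N $$ (j, k)) * v $ k) = z * v $ j" if j: "j < n" for j
    proof -
      have "(M *\<^sub>v v) $ j = (z \<cdot>\<^sub>v v) $ j" using v by simp
      then show ?thesis using j N v(1)
        by (auto simp: M_def scalar_prod_def atLeast0LessThan)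
    qed
    have "N *\<^sub>v x = Re z \<cdot>\<^sub>v x - Im z \<cdot>\<^sub>v y"
    proof (rule eq_vecI)
      fix j assume "j < dim_vec (Re z \<cdot>\<^sub>v x - Im z \<cdot>\<^sub>v y)"
      then have j: "j < n" using xy by simp
      have "(N *\<^sub>v x) $ j = (\<Sum>k<n. N $$ (j, k) * Re (v $ k))"
        using j N v(1) by (auto simp: x_def scalar_prod_def atLeast0LessThan)
      also have "\<dots> = Re (z * v $ j)"
        unfolding comp[OF j, symmetric] by simp
      finally show "(N *\<^sub>v x) $ j = (Re z \<cdot>\<^sub>v x - Im z \<cdot>\<^sub>v y) $ j"
        using j v(1) by (simp add: x_def y_def)
    qed (use N xy in auto)
    moreover have "N *\<^sub>v y = Re z \<cdot>\<^sub>v y + Im z \<cdot>\<^sub>v x"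
    proof (rule eq_vecI)
      fix j assume "j < dim_vec (Re z \<cdot>\<^sub>v y + Im z \<cdot>\<^sub>v x)"
      then have j: "j < n" using xy by simp
      have "(N *\<^sub>v y) $ j = (\<Sum>k<n. N $$ (j, k) * Im (v $ k))"
        using j N v(1) by (auto simp: y_def scalar_prod_def atLeast0LessThan)
      also have "\<dots> = Im (z * v $ j)"
        unfolding comp[OF j, symmetric] by simp
      finally show "(N *\<^sub>v y) $ j = (Re z \<cdot>\<^sub>v y + Im z \<cdot>\<^sub>v x) $ j"
        using j v(1) by (simp add: x_def y_def)
    qed (use N xy in auto)
    ultimately have "Im z = 0 \<and> \<bar>Re z\<bar> \<le> 1 / 2" using eigen xy by blast
    then show ?thesis unfolding z_def[symmetric]
      by (intro exI[of _ "Re z"]) (auto simp: complex_eq_iff)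
  qed
  then obtain r where r: "\<And>i. i < n \<Longrightarrow> B $$ (i, i) = complex_of_real (r i)"
    "\<And>i. i < n \<Longrightarrow> \<bar>r i\<bar> \<le> 1 / 2" by metis
  have "complex_of_real (mat_trace N) = (\<Sum>i<n. M $$ (i, i))"
    using N by (simp add: mat_trace_def M_def)
  also have "\<dots> = (\<Sum>i<n. B $$ (i, i))" by (rule sum_diag_similar[OF wit M])
  also have "\<dots> = complex_of_real (\<Sum>i<n. r i)" using r by simp
  finally have tr1: "mat_trace N = (\<Sum>i<n. r i)" by (simp only: of_real_eq_iff)
  have NN: "map_mat complex_of_real (N * N) = M * M"
    unfolding M_def using N of_real_hom.mat_hom_mult[of N n n N n] by blast
  \<comment> \<open>The same \<open>P\<close> and \<open>Q\<close> conjugate the squares, so the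
    trace of \<open>N * N\<close> is the sum of the squared diagonal entries.\<close>
  have wit2: "similar_mat_wit (M * M) (B * B) P Q"
  proof (rule similar_mat_witI[of _ _ n])
    have "M * M = P * B * Q * (P * B * Q)" using w(3) by simp
    also have "\<dots> = P * B * (Q * P) * B * Q"
      using w(4-7) by (simp add: assoc_mult_mat[of _ n n _ n _ n])
    also have "\<dots> = P * (B * B) * Q"
      using w(2,4-7) by (simp add: assoc_mult_mat[of _ n n _ n _ n])
    finally show "M * M = P * (B * B) * Q" .
  qed (use w in auto)
  have "complex_of_real (mat_trace (N * N)) = (\<Sum>i<n. (M * M) $$ (i, i))"
    using N by (simp add: mat_trace_def NN[symmetric])
  also have "\<dots> = (\<Sum>i<n. (B * B) $$ (i, i))" 
    using M by (intro sum_diag_similar[OF wit2]) auto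
  also have "\<dots> = complex_of_real (\<Sum>i<n. (r i)\<^sup>2)"
    using r upper_triangular_square_diag[OF tri B] by simp
  finally have tr2: "mat_trace (N * N) = (\<Sum>i<n. (r i)\<^sup>2)" by (simp only: of_real_eq_iff)
  have sim': "similar_mat (1\<^sub>m n - M) (1\<^sub>m n - B)"
    unfolding similar_mat_def
  proof (intro exI, rule similar_mat_witI[of _ _ n])
    have "P * (1\<^sub>m n - B) * Q = P * 1\<^sub>m n * Q - P * B * Q"
      using w by (simp add: minus_mult_distrib_mat[of _ n n _ _ n] mult_minus_distrib_mat[of _ n n _ n])
    then show "1\<^sub>m n - M = P * (1\<^sub>m n - B) * Q" using w by simp
  qed (use w in auto)
  have "map_mat complex_of_real (1\<^sub>m n - N) = 1\<^sub>m n - M"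
    unfolding M_def using N by (intro eq_matI) auto
  then have "complex_of_real (Determinant.det (1\<^sub>m n - N)) = Determinant.det (1\<^sub>m n - M)"
    using of_real_hom.hom_det[of "1\<^sub>m n - N"] by metis
  also have "\<dots> = Determinant.det (1\<^sub>m n - B)" by (rule det_similar[OF sim'])
  also have "\<dots> = prod_list (diag_mat (1\<^sub>m n - B))"
  proof (rule det_upper_triangular)
    show "upper_triangular (1\<^sub>m n - B)"
    proof (rule upper_triangularI)
      fix i j assume ij: "j < i" "i < dim_row (1\<^sub>m n - B)"
      then show "(1\<^sub>m n - B) $$ (i, j) = 0"
        using B upper_triangularD[OF tri, of j i] by auto
    qed
  qed (use B in auto)
  also have "\<dots> = (\<Prod>i<n. 1 - B $$ (i, i))"
    using B by (simp add: diag_mat_def atLeast0LessThan[symmetric] prod.distinct_set_conv_list[symmetric])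
  also have "\<dots> = complex_of_real (\<Prod>i<n. 1 - r i)" using r by simp
  finally have det: "Determinant.det (1\<^sub>m n - N) = (\<Prod>i<n. 1 - r i)" by (simp only: of_real_eq_iff)
  have "exp (- mat_trace N - mat_trace (N * N)) = exp (\<Sum>i<n. - r i - (r i)\<^sup>2)"
    unfolding tr1 tr2 by (simp add: sum_subtractf sum_negf)
  also have "\<dots> = (\<Prod>i<n. exp (- r i - (r i)\<^sup>2))" by (simp add: exp_sum)
  also have "\<dots> \<le> (\<Prod>i<n. 1 - r i)"
    using r exp_le_one_minus by (intro prod_mono) auto
  finally show ?thesis unfolding det .
qed

subsection \<open>Gaussian integrals\<close>

text \<open>The argument is a function on indices, not a \<open>vec\<close>, so that the form is
  visibly measurable on the product space and a point can be extended by one coordinate through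
  function update.\<close>

definition quad_form :: "nat \<Rightarrow> real mat \<Rightarrow> (nat \<Rightarrow> real) \<Rightarrow> real" where
  "quad_form p Q x = (\<Sum>i<p. \<Sum>j<p. Q $$ (i, j) * x i * x j)"

lemma quad_form_eq:
  assumes "Q \<in> carrier_mat p p"
  shows "vec p x \<bullet> (Q *\<^sub>v vec p x) = quad_form p Q x"
  using assms
  by (auto simp: quad_form_def scalar_prod_def atLeast0LessThan sum_distrib_left mult_ac intro!: sum.cong)

lemma quad_form_cong:
  "(\<And>i. i < p \<Longrightarrow> x i = y i) \<Longrightarrow> quad_form p Q x = quad_form p Q y"
  by (simp add: quad_form_def)

lemma measurable_quad_form [measurable]:
  "quad_form p Q \<in> borel_measurable (Pi\<^sub>M {..<p} (\<lambda>_. lborel))"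
  unfolding quad_form_def by measurable

lemma sym_pos_def_quad_form:
  "Q \<in> sym_pos_def p \<longleftrightarrow> Q \<in> carrier_mat p p \<and> (\<forall>i<p. \<forall>j<p. Q $$ (i, j) = Q $$ (j, i)) \<and>
     (\<forall>x. (\<exists>i<p. x i \<noteq> 0) \<longrightarrow> quad_form p Q x > 0)"
proof (cases "Q \<in> carrier_mat p p")
  case Q: True
  have sym: "transpose_mat Q = Q \<longleftrightarrow> (\<forall>i<p. \<forall>j<p. Q $$ (i, j) = Q $$ (j, i))"
    using Q by (auto simp: mat_eq_iff)
  have "(\<forall>v\<in>carrier_vec p. v \<noteq> 0\<^sub>v p \<longrightarrow> v \<bullet> (Q *\<^sub>v v) > 0) \<longleftrightarrow>
     (\<forall>x. (\<exists>i<p. x i \<noteq> 0) \<longrightarrow> quad_form p Q x > 0)"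
  proof (intro iffI allI ballI impI)
    fix x :: "nat \<Rightarrow> real" assume *: "\<forall>v\<in>carrier_vec p. v \<noteq> 0\<^sub>v p \<longrightarrow> v \<bullet> (Q *\<^sub>v v) > 0" "\<exists>i<p. x i \<noteq> 0"
    have "vec p x \<noteq> 0\<^sub>v p" using *(2) by (auto simp: vec_eq_iff)
    then have "vec p x \<bullet> (Q *\<^sub>v vec p x) > 0" using *(1) by simp
    then show "quad_form p Q x > 0" by (simp add: quad_form_eq[OF Q])
  next
    fix v :: "real vec" assume *: "\<forall>x. (\<exists>i<p. x i \<noteq> 0) \<longrightarrow> quad_form p Q x > 0" "v \<in> carrier_vec p" "v \<noteq> 0\<^sub>v p"
    have v: "v = vec p (($) v)" using *(2) by auto
    have "\<exists>i<p. v $ i \<noteq> 0" using *(2,3) by (auto simp: vec_eq_iff)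
    then have "quad_form p Q (($) v) > 0" using *(1) by blast
    then show "v \<bullet> (Q *\<^sub>v v) > 0" using quad_form_eq[OF Q, of "($) v"] v by simp
  qed
  with Q sym show ?thesis by (simp add: sym_pos_def_def)
qed (auto simp: sym_pos_def_def)

text \<open>Up to the factor sqrt (2 pi / d) the integrand is the normal density with mean - m and
  variance 1 / d, whose total mass is 1.\<close>

lemma nn_integral_gaussian_1d:
  fixes d m :: real
  assumes "d > 0"
  shows "(\<integral>\<^sup>+ y. ennreal (exp (- (d * (y + m)\<^sup>2) / 2)) \<partial>lborel) = ennreal (sqrt (2 * pi / d))"
proof -
  define \<sigma> where "\<sigma> = 1 / sqrt d"
  have \<sigma>: "\<sigma> > 0" "\<sigma>\<^sup>2 = 1 / d" using assms by (auto simp: \<sigma>_def power_divide)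
  have eq: "exp (- (d * (y + m)\<^sup>2) / 2) = sqrt (2 * pi / d) * normal_density (- m) \<sigma> y" for y
    using assms \<sigma> by (simp add: normal_density_def)
  have "(\<integral>\<^sup>+ y. ennreal (exp (- (d * (y + m)\<^sup>2) / 2)) \<partial>lborel)
      = (\<integral>\<^sup>+ y. ennreal (sqrt (2 * pi / d)) * ennreal (normal_density (- m) \<sigma> y) \<partial>lborel)"
    unfolding eq using assms by (simp add: ennreal_mult)
  also have "\<dots> = ennreal (sqrt (2 * pi / d)) * (\<integral>\<^sup>+ y. ennreal (normal_density (- m) \<sigma> y) \<partial>lborel)"
    by (rule nn_integral_cmult) simp
  also have "(\<integral>\<^sup>+ y. ennreal (normal_density (- m) \<sigma> y) \<partial>lborel) = 1"
    using \<sigma> by (subst nn_integral_eq_integral) (auto simp: normal_density_nonneg)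
  finally show ?thesis by simp
qed

text \<open>The complement of the last diagonal entry of a matrix of size p + 1. Column p also
  stands in for row p, so the formula is meant for symmetric \<open>Q\<close>.\<close>

definition schur_complement :: "nat \<Rightarrow> real mat \<Rightarrow> real mat" where
  "schur_complement p Q = mat p p (\<lambda>(i, j). Q $$ (i, j) - Q $$ (i, p) * Q $$ (j, p) / Q $$ (p, p))"

text \<open>Completing the square in the last coordinate.\<close>

lemma quad_form_schur_complement:
  assumes sym: "\<And>i j. i < Suc p \<Longrightarrow> j < Suc p \<Longrightarrow> Q $$ (i, j) = Q $$ (j, i)" and d: "Q $$ (p, p) \<noteq> 0"
  shows "quad_form (Suc p) Q x = quad_form p (schur_complement p Q) x +
    Q $$ (p, p) * (x p + (\<Sum>i<p. Q $$ (i, p) * x i) / Q $$ (p, p))\<^sup>2"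
proof -
  define c where "c = (\<Sum>i<p. Q $$ (i, p) * x i)"
  define d where "d = Q $$ (p, p)"
  have c2: "c\<^sup>2 = (\<Sum>i<p. \<Sum>j<p. (Q $$ (i, p) * x i) * (Q $$ (j, p) * x j))"
    by (simp add: c_def power2_eq_square sum_product)
  have "quad_form (Suc p) Q x = (\<Sum>i<p. \<Sum>j<p. Q $$ (i, j) * x i * x j) + (\<Sum>i<p. Q $$ (i, p) * x i * x p)
      + ((\<Sum>j<p. Q $$ (p, j) * x p * x j) + d * x p * x p)"
    by (simp add: quad_form_def d_def sum.distrib)
  also have "(\<Sum>i<p. Q $$ (i, p) * x i * x p) = c * x p"
    by (simp add: c_def sum_distrib_right)
  also have "(\<Sum>j<p. Q $$ (p, j) * x p * x j) = c * x p"
    unfolding c_def sum_distrib_right using sym by (intro sum.cong) auto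
  finally have 1: "quad_form (Suc p) Q x
     = (\<Sum>i<p. \<Sum>j<p. Q $$ (i, j) * x i * x j) + c * x p + (c * x p + d * x p * x p)" .
  have "quad_form p (schur_complement p Q) x
     = (\<Sum>i<p. \<Sum>j<p. Q $$ (i, j) * x i * x j) - c\<^sup>2 / d"
    unfolding c2 by (simp add: quad_form_def schur_complement_def d_def sum_subtractf
      sum_divide_distrib algebra_simps)
  moreover have "d * (x p + c / d)\<^sup>2 = d * x p * x p + 2 * c * x p + c\<^sup>2 / d"
    using d unfolding d_def[symmetric] by (simp add: field_simps power2_eq_square)
  ultimately show ?thesis
    unfolding c_def[symmetric] d_def[symmetric] 1 by simp
qed

text \<open>Block elimination: \<open>Q\<close> is the product of a block upper triangular matrix
  with diagonal blocks \<open>schur_complement p Q\<close> and Q(p, p), and a block lower triangular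
  matrix with identity blocks on its diagonal.\<close>

lemma det_schur_complement:
  assumes Q: "Q \<in> carrier_mat (Suc p) (Suc p)"
    and sym: "\<And>i j. i < Suc p \<Longrightarrow> j < Suc p \<Longrightarrow> Q $$ (i, j) = Q $$ (j, i)" and d: "Q $$ (p, p) \<noteq> 0"
  shows "Determinant.det Q = Q $$ (p, p) * Determinant.det (schur_complement p Q)"
proof -
  define c where "c = mat p 1 (\<lambda>(i, j). Q $$ (i, p))"
  define r where "r = mat 1 p (\<lambda>(i, j). Q $$ (j, p) / Q $$ (p, p))"
  define D where "D = mat 1 1 (\<lambda>(i, j). Q $$ (p, p))"
  let ?S = "schur_complement p Q"
  let ?L = "four_block_mat ?S c (0\<^sub>m 1 p) D"
  let ?U = "four_block_mat (1\<^sub>m p) (0\<^sub>m p 1) r (1\<^sub>m 1)"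
  have S: "?S \<in> carrier_mat p p" by (simp add: schur_complement_def)
  have cs: "c \<in> carrier_mat p 1" "r \<in> carrier_mat 1 p" "D \<in> carrier_mat 1 1"
    by (auto simp: c_def r_def D_def)
  have "?L * ?U = four_block_mat (?S * 1\<^sub>m p + c * r) (?S * 0\<^sub>m p 1 + c * 1\<^sub>m 1)
      (0\<^sub>m 1 p * 1\<^sub>m p + D * r) (0\<^sub>m 1 p * 0\<^sub>m p 1 + D * 1\<^sub>m 1)"
    using S cs by (intro mult_four_block_mat) auto
  also have "\<dots> = four_block_mat (?S + c * r) c (D * r) D"
    using S cs by simp
  also have "\<dots> = Q"
  proof (rule eq_matI)
    fix i j assume "i < dim_row Q" "j < dim_col Q"
    then have ij: "i < Suc p" "j < Suc p" using Q by auto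
    then show "four_block_mat (?S + c * r) c (D * r) D $$ (i, j) = Q $$ (i, j)"
      using S cs d sym[of p j]
      by (cases "i < p"; cases "j < p")
        (auto simp: schur_complement_def c_def r_def D_def scalar_prod_def less_Suc_eq)
  qed (use Q S cs in \<open>auto simp: schur_complement_def\<close>)
  finally have "Determinant.det Q = Determinant.det ?L * Determinant.det ?U"
    using S cs det_mult[OF four_block_carrier_mat[OF S cs(3)] four_block_carrier_mat[OF one_carrier_mat one_carrier_mat],
      of c "0\<^sub>m 1 p" "0\<^sub>m p 1" r] by simp
  also have "Determinant.det ?L = Determinant.det ?S * Determinant.det D"
    using S cs by (intro det_four_block_mat_lower_left_zero) auto
  also have "Determinant.det ?U = Determinant.det (1\<^sub>m p :: real mat) * Determinant.det (1\<^sub>m 1 :: real mat)"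
    using cs by (intro det_four_block_mat_upper_right_zero) auto
  also have "Determinant.det D = Q $$ (p, p)"
    using cs by (simp add: det_single D_def)
  finally show ?thesis by simp
qed

text \<open>Induction on the dimension. After completing the square, the last coordinate integrates
  to sqrt (2 pi / d) whatever the others are, and the Schur complement remains as a form in one
  dimension less. Positivity of the determinant comes out of the same induction, as a product of
  positive pivots.\<close>

lemma gaussian_integral:
  assumes "Q \<in> sym_pos_def p"
  shows "Determinant.det Q > 0"
    and "(\<integral>\<^sup>+ x. ennreal (exp (- quad_form p Q x / 2)) \<partial>Pi\<^sub>M {..<p} (\<lambda>_. lborel))
       = ennreal (sqrt ((2 * pi) ^ p / Determinant.det Q))"
proof -
  interpret product_sigma_finite "\<lambda>_::nat. lborel :: real measure" ..
  have "Determinant.det Q > 0 \<and> 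
     (\<integral>\<^sup>+ x. ennreal (exp (- quad_form p Q x / 2)) \<partial>Pi\<^sub>M {..<p} (\<lambda>_. lborel))
       = ennreal (sqrt ((2 * pi) ^ p / Determinant.det Q))"
    using assms
  proof (induction p arbitrary: Q)
    case 0
    then have "Determinant.det Q = 1" by (auto simp: sym_pos_def_def)
    then show ?case by (simp add: quad_form_def PiM_empty nn_integral_count_space_finite)
  next
    case (Suc p)
    from Suc.prems have Q: "Q \<in> carrier_mat (Suc p) (Suc p)"
      and sym: "\<And>i j. i < Suc p \<Longrightarrow> j < Suc p \<Longrightarrow> Q $$ (i, j) = Q $$ (j, i)"
      and pos: "\<And>x. \<exists>i<Suc p. x i \<noteq> 0 \<Longrightarrow> quad_form (Suc p) Q x > 0"
      unfolding sym_pos_def_quad_form by blast+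
    define d where "d = Q $$ (p, p)"
    \<comment> \<open>The pivot is the value of the form at the last unit vector, hence
      positive.\<close>
    have "quad_form (Suc p) Q (\<lambda>i. if i = p then 1 else 0) > 0"
      by (rule pos) auto
    also have "quad_form (Suc p) Q (\<lambda>i. if i = p then 1 else 0) = d"
      by (simp add: quad_form_def d_def)
    finally have d: "d > 0" .
    let ?S = "schur_complement p Q"
    define m where "m = (\<lambda>x. (\<Sum>i<p. Q $$ (i, p) * x i) / d)"
    have split: "quad_form (Suc p) Q x = quad_form p ?S x + d * (x p + m x)\<^sup>2" for x
      using quad_form_schur_complement[OF sym, where x = x] d by (simp add: d_def m_def)
    have split': "quad_form (Suc p) Q (x(p := y)) = quad_form p ?S x + d * (y + m x)\<^sup>2" for x y
    proof -
      have "quad_form p ?S (x(p := y)) = quad_form p ?S x" by (rule quad_form_cong) auto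
      then show ?thesis using split[of "x(p := y)"] by (simp add: m_def)
    qed
    have S: "?S \<in> sym_pos_def p"
      unfolding sym_pos_def_quad_form
    proof (intro conjI allI impI)
      fix x :: "nat \<Rightarrow> real" assume "\<exists>i<p. x i \<noteq> 0"
      \<comment> \<open>The last coordinate - m x makes the completed square vanish, so positivity
        of \<open>Q\<close> passes to the Schur complement.\<close>
      then have "\<exists>i<Suc p. (x(p := - m x)) i \<noteq> 0" by fastforce
      then have "quad_form (Suc p) Q (x(p := - m x)) > 0" by (rule pos)
      then show "quad_form p ?S x > 0" unfolding split' by simp
    qed (use sym in \<open>auto simp: schur_complement_def\<close>)
    note IH = Suc.IH[OF S]
    have det: "Determinant.det Q = d * Determinant.det ?S"
      unfolding d_def using det_schur_complement[OF Q sym] d by (simp add: d_def)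
    have [measurable]: "(\<lambda>x. exp (- quad_form p ?S x / 2)) \<in> borel_measurable (Pi\<^sub>M {..<p} (\<lambda>_. lborel))"
      by measurable
    have meas: "(\<lambda>x. ennreal (exp (- quad_form (Suc p) Q x / 2)))
        \<in> borel_measurable (Pi\<^sub>M (insert p {..<p}) (\<lambda>_. lborel))"
      unfolding lessThan_Suc[symmetric] by measurable
    have "(\<integral>\<^sup>+ x. ennreal (exp (- quad_form (Suc p) Q x / 2)) \<partial>Pi\<^sub>M {..<Suc p} (\<lambda>_. lborel))
       = (\<integral>\<^sup>+ x. \<integral>\<^sup>+ y. ennreal (exp (- quad_form (Suc p) Q (x(p := y)) / 2)) \<partial>lborel \<partial>Pi\<^sub>M {..<p} (\<lambda>_. lborel))"
      unfolding lessThan_Suc by (rule product_nn_integral_insert[OF _ _ meas]) auto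
    also have "\<dots> = (\<integral>\<^sup>+ x. ennreal (exp (- quad_form p ?S x / 2)) * ennreal (sqrt (2 * pi / d)) \<partial>Pi\<^sub>M {..<p} (\<lambda>_. lborel))"
    proof (rule nn_integral_cong)
      fix x :: "nat \<Rightarrow> real"
      have "(\<integral>\<^sup>+ y. ennreal (exp (- quad_form (Suc p) Q (x(p := y)) / 2)) \<partial>lborel)
         = (\<integral>\<^sup>+ y. ennreal (exp (- quad_form p ?S x / 2)) * ennreal (exp (- (d * (y + m x)\<^sup>2) / 2)) \<partial>lborel)"
        unfolding split' by (simp add: ennreal_mult[symmetric] exp_add[symmetric] add_divide_distrib diff_divide_distrib)
      also have "\<dots> = ennreal (exp (- quad_form p ?S x / 2)) * ennreal (sqrt (2 * pi / d))"
        using nn_integral_gaussian_1d[OF d, of "m x"] by (subst nn_integral_cmult) auto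
      finally show "(\<integral>\<^sup>+ y. ennreal (exp (- quad_form (Suc p) Q (x(p := y)) / 2)) \<partial>lborel)
         = ennreal (exp (- quad_form p ?S x / 2)) * ennreal (sqrt (2 * pi / d))" .
    qed
    also have "\<dots> = ennreal (sqrt ((2 * pi) ^ p / Determinant.det ?S)) * ennreal (sqrt (2 * pi / d))"
      using IH by (subst nn_integral_multc) auto
    also have "\<dots> = ennreal (sqrt ((2 * pi) ^ p / Determinant.det ?S) * sqrt (2 * pi / d))"
      using IH d by (intro ennreal_mult[symmetric]) auto
    also have "sqrt ((2 * pi) ^ p / Determinant.det ?S) * sqrt (2 * pi / d)
       = sqrt ((2 * pi) ^ Suc p / Determinant.det Q)"
      unfolding det real_sqrt_mult[symmetric] by (simp add: mult_ac)
    finally show ?case using IH d by (simp add: det)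
  qed
  then show "Determinant.det Q > 0"
    and "(\<integral>\<^sup>+ x. ennreal (exp (- quad_form p Q x / 2)) \<partial>Pi\<^sub>M {..<p} (\<lambda>_. lborel))
       = ennreal (sqrt ((2 * pi) ^ p / Determinant.det Q))" by auto
qed

section \<open>Inverse covariance matrices and exponential moments of quadratic forms\<close>

lemma scalar_prod_mult_sym:
  fixes A :: "real mat"
  assumes "A \<in> carrier_mat p p" "transpose_mat A = A" "x \<in> carrier_vec p" "y \<in> carrier_vec p"
  shows "x \<bullet> (A *\<^sub>v y) = y \<bullet> (A *\<^sub>v x)"
proof -
  have "x \<bullet> (A *\<^sub>v y) = (A *\<^sub>v x) \<bullet> y"
    using transpose_vec_mult_scalar[OF assms(1,4,3)] assms(2) by simp
  also have "\<dots> = y \<bullet> (A *\<^sub>v x)" using assms by (intro comm_scalar_prod[of _ p]) auto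
  finally show ?thesis .
qed

text \<open>The determinant is positive by \<open>gaussian_integral\<close>, so
  \<open>mat_inverse\<close> returns a value. Its symmetry follows from evaluating B^T \<Sigma> B in
  two ways.\<close>

lemma sym_pos_def_inverse:
  assumes Sg: "\<Sigma> \<in> sym_pos_def p"
  obtains B where "the (mat_inverse \<Sigma>) = B" "B \<in> carrier_mat p p" "transpose_mat B = B"
    "\<Sigma> * B = 1\<^sub>m p" "B * \<Sigma> = 1\<^sub>m p"
proof -
  have c: "\<Sigma> \<in> carrier_mat p p" and sym: "transpose_mat \<Sigma> = \<Sigma>" using Sg by (auto simp: sym_pos_def_def)
  have "Determinant.det \<Sigma> \<noteq> 0" using gaussian_integral(1)[OF Sg] by simp
  then have "\<Sigma> \<in> Units (ring_mat TYPE(real) p ())"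
    by (rule det_non_zero_imp_unit[OF c])
  then obtain B where B: "mat_inverse \<Sigma> = Some B"
    using mat_inverse(1)[OF c, of "()"] by (cases "mat_inverse \<Sigma>") auto
  note b = mat_inverse(2)[OF c B]
  have "transpose_mat B = transpose_mat B * (\<Sigma> * B)" using b by (simp add: right_mult_one_mat[of _ p p])
  also have "\<dots> = (transpose_mat B * transpose_mat \<Sigma>) * B"
    using b c sym by (simp add: assoc_mult_mat[of _ p p _ p _ p])
  also have "transpose_mat B * transpose_mat \<Sigma> = transpose_mat (\<Sigma> * B)"
    using b c transpose_mult[of \<Sigma> p p B p] by metis
  also have "\<dots> * B = B" using b by (metis left_mult_one_mat transpose_one)
  finally show thesis using that[of B] B b by simp
qed

text \<open>Multiplying the density by the exponential replaces the precision matrix B by B - C,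
  again a Gaussian integral. The ratio of the normalising constants is governed by det (B - C) det
  \<Sigma> = det (1 - C \<Sigma>).\<close>

lemma gaussian_nn_integral_exp:
  assumes Sg: "\<Sigma> \<in> sym_pos_def p" and C: "C \<in> carrier_mat p p"
    and pd: "the (mat_inverse \<Sigma>) - C \<in> sym_pos_def p"
  shows "Determinant.det (1\<^sub>m p - C * \<Sigma>) > 0"
    and "(\<integral>\<^sup>+ x. ennreal (exp (quad_form p C x / 2)) \<partial>gaussian p \<Sigma>)
       = ennreal (1 / sqrt (Determinant.det (1\<^sub>m p - C * \<Sigma>)))"
proof -
  have c: "\<Sigma> \<in> carrier_mat p p" using Sg by (auto simp: sym_pos_def_def)
  obtain B where B: "the (mat_inverse \<Sigma>) = B" "B \<in> carrier_mat p p" "B * \<Sigma> = 1\<^sub>m p"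
    using sym_pos_def_inverse[OF Sg] by metis
  define Q where "Q = B - C"
  have Q: "Q \<in> sym_pos_def p" "Q \<in> carrier_mat p p" using pd B C by (auto simp: Q_def)
  note Sp = gaussian_integral[OF Sg] and Qp = gaussian_integral[OF Q(1)]
  have "Q * \<Sigma> = 1\<^sub>m p - C * \<Sigma>"
    unfolding Q_def using B C c by (simp add: minus_mult_distrib_mat[of _ p p _ _ p])
  then have det: "Determinant.det (1\<^sub>m p - C * \<Sigma>) = Determinant.det Q * Determinant.det \<Sigma>"
    using det_mult[OF Q(2) c] by simp
  then show "Determinant.det (1\<^sub>m p - C * \<Sigma>) > 0" using Sp(1) Qp(1) by simp
  define K where "K = sqrt ((2 * pi) ^ p * Determinant.det \<Sigma>)"
  have K: "K > 0" using Sp(1) by (simp add: K_def)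
  have quad: "quad_form p Q x = quad_form p B x - quad_form p C x" for x
    using B C by (simp add: quad_form_def Q_def sum_subtractf[symmetric] algebra_simps)
  have dens: "gaussian_density p \<Sigma> x = exp (- quad_form p B x / 2) / K" for x
    using B by (simp add: gaussian_density_def quad_form_eq K_def)
  have "(\<integral>\<^sup>+ x. ennreal (exp (quad_form p C x / 2)) \<partial>gaussian p \<Sigma>) =
     (\<integral>\<^sup>+ x. ennreal (gaussian_density p \<Sigma> x) * ennreal (exp (quad_form p C x / 2)) \<partial>Pi\<^sub>M {..<p} (\<lambda>_. lborel))"
    unfolding gaussian_def by (rule nn_integral_density) (simp_all add: dens)
  also have "\<dots> = (\<integral>\<^sup>+ x. ennreal (1 / K) * ennreal (exp (- quad_form p Q x / 2)) \<partial>Pi\<^sub>M {..<p} (\<lambda>_. lborel))"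
    using K by (intro nn_integral_cong)
      (simp add: dens ennreal_mult[symmetric] exp_add[symmetric] quad diff_divide_distrib)
  also have "\<dots> = ennreal (1 / K) * (\<integral>\<^sup>+ x. ennreal (exp (- quad_form p Q x / 2)) \<partial>Pi\<^sub>M {..<p} (\<lambda>_. lborel))"
    by (rule nn_integral_cmult) measurable
  also have "\<dots> = ennreal (1 / K * sqrt ((2 * pi) ^ p / Determinant.det Q))"
    unfolding Qp(2) using K Qp(1) by (intro ennreal_mult[symmetric]) auto
  also have "1 / K * sqrt ((2 * pi) ^ p / Determinant.det Q) = 1 / sqrt (Determinant.det (1\<^sub>m p - C * \<Sigma>))"
    using Sp(1) Qp(1) unfolding det K_def by (simp add: real_sqrt_mult real_sqrt_divide)
  finally show "(\<integral>\<^sup>+ x. ennreal (exp (quad_form p C x / 2)) \<partial>gaussian p \<Sigma>)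
       = ennreal (1 / sqrt (Determinant.det (1\<^sub>m p - C * \<Sigma>)))" .
qed

lemma sets_gaussian [simp, measurable_cong]: "sets (gaussian p \<Sigma>) = sets (Pi\<^sub>M {..<p} (\<lambda>_. borel))"
  by (simp add: gaussian_def cong: sets_PiM_cong)

text \<open>Since v = \<Sigma> (B v), the form of B at v is the form of \<Sigma> at B v, and B v is
  nonzero when v is.\<close>

lemma sym_pos_def_inverse_sym_pos_def:
  assumes Sg: "\<Sigma> \<in> sym_pos_def p"
  shows "the (mat_inverse \<Sigma>) \<in> sym_pos_def p"
proof -
  have c: "\<Sigma> \<in> carrier_mat p p" using Sg by (auto simp: sym_pos_def_def)
  obtain B where B: "the (mat_inverse \<Sigma>) = B" "B \<in> carrier_mat p p" "transpose_mat B = B" "\<Sigma> * B = 1\<^sub>m p"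
    using sym_pos_def_inverse[OF Sg] by metis
  have "v \<bullet> (B *\<^sub>v v) > 0" if v: "v \<in> carrier_vec p" "v \<noteq> 0\<^sub>v p" for v
  proof -
    have "\<Sigma> *\<^sub>v (B *\<^sub>v v) = v" 
      using assoc_mult_mat_vec[OF c B(2) v(1)] B v by simp
    moreover have "\<Sigma> *\<^sub>v 0\<^sub>v p = 0\<^sub>v p" using c by (intro eq_vecI) auto
    ultimately have "\<Sigma> *\<^sub>v (B *\<^sub>v v) = v" "B *\<^sub>v v \<noteq> 0\<^sub>v p" using v by auto
    then have "(B *\<^sub>v v) \<bullet> v > 0"
      using Sg B v by (auto simp: sym_pos_def_def dest!: bspec[of _ _ "B *\<^sub>v v"])
    then show ?thesis using comm_scalar_prod[of v p "B *\<^sub>v v"] B v by simp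
  qed
  with B show ?thesis by (auto simp: sym_pos_def_def)
qed

text \<open>The case C = 0 of \<open>gaussian_nn_integral_exp\<close>: the integrand and the
  determinant are both 1.\<close>

lemma prob_space_gaussian:
  assumes Sg: "\<Sigma> \<in> sym_pos_def p"
  shows "prob_space (gaussian p \<Sigma>)"
proof
  have c: "\<Sigma> \<in> carrier_mat p p" using Sg by (auto simp: sym_pos_def_def)
  have B: "the (mat_inverse \<Sigma>) \<in> carrier_mat p p" 
    using sym_pos_def_inverse_sym_pos_def[OF Sg] by (auto simp: sym_pos_def_def)
  have "the (mat_inverse \<Sigma>) - 0\<^sub>m p p = the (mat_inverse \<Sigma>)" using B by auto
  moreover have "1\<^sub>m p - 0\<^sub>m p p * \<Sigma> = 1\<^sub>m p" using c by auto
  moreover have "quad_form p (0\<^sub>m p p) x = 0" for x by (simp add: quad_form_def)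
  ultimately show "emeasure (gaussian p \<Sigma>) (space (gaussian p \<Sigma>)) = 1"
    using gaussian_nn_integral_exp(2)[OF Sg, of "0\<^sub>m p p"] sym_pos_def_inverse_sym_pos_def[OF Sg] by simp
qed

subsection \<open>Concentration of Gaussian quadratic forms\<close>

text \<open>This is \<Sigma>^2 \<le> b \<Sigma> as quadratic forms, obtained without diagonalising
  \<Sigma>: expand the nonnegative form of \<Sigma> at w - \<Sigma> w / b and bound its last term by
  the hypothesis at \<Sigma> w.\<close>

lemma norm_mult_sym_pos_def_le:
  assumes Sg: "\<Sigma> \<in> sym_pos_def p" and b: "b > 0"
    and bound: "\<And>v. v \<in> carrier_vec p \<Longrightarrow> v \<bullet> (\<Sigma> *\<^sub>v v) \<le> b * (v \<bullet> v)"
    and w: "w \<in> carrier_vec p"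
  shows "(\<Sigma> *\<^sub>v w) \<bullet> (\<Sigma> *\<^sub>v w) \<le> b * (w \<bullet> (\<Sigma> *\<^sub>v w))"
proof -
  have c: "\<Sigma> \<in> carrier_mat p p" and sym: "transpose_mat \<Sigma> = \<Sigma>" using Sg by (auto simp: sym_pos_def_def)
  define v where "v = \<Sigma> *\<^sub>v w"
  have v: "v \<in> carrier_vec p" using c w by (simp add: v_def)
  define z where "z = w - (1 / b) \<cdot>\<^sub>v v"
  have z: "z \<in> carrier_vec p" using w v by (simp add: z_def)
  have Sz: "\<Sigma> *\<^sub>v z = v - (1 / b) \<cdot>\<^sub>v (\<Sigma> *\<^sub>v v)"
    unfolding z_def using c w v
    by (simp add: mult_minus_distrib_mat_vec[of _ p p] mult_mat_vec[of _ p p] v_def[symmetric])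
  have "0 \<le> z \<bullet> (\<Sigma> *\<^sub>v z)"
  proof (cases "z = 0\<^sub>v p")
    case True
    then show ?thesis using c by (simp add: scalar_prod_left_zero)
  qed (use Sg z in \<open>force simp: sym_pos_def_def\<close>)
  also have "z \<bullet> (\<Sigma> *\<^sub>v z) = w \<bullet> v - 1 / b * (w \<bullet> (\<Sigma> *\<^sub>v v)) - 1 / b * (v \<bullet> v) + 1 / b * (1 / b) * (v \<bullet> (\<Sigma> *\<^sub>v v))"
    unfolding Sz unfolding z_def using c w v
    by (simp add: minus_scalar_prod_distrib[of _ p] scalar_prod_minus_distrib[of _ p] algebra_simps)
  also have "w \<bullet> (\<Sigma> *\<^sub>v v) = v \<bullet> v"
    using scalar_prod_mult_sym[OF c sym w v] by (simp add: v_def)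
  finally have "0 \<le> w \<bullet> v - 2 / b * (v \<bullet> v) + 1 / b * (1 / b) * (v \<bullet> (\<Sigma> *\<^sub>v v))" by simp
  also have "1 / b * (1 / b) * (v \<bullet> (\<Sigma> *\<^sub>v v)) \<le> 1 / b * (1 / b) * (b * (v \<bullet> v))"
    using b bound[OF v] by (intro mult_left_mono) auto
  finally have "(v \<bullet> v) / b \<le> w \<bullet> v" using b by (simp add: field_simps)
  then show ?thesis using b by (simp add: v_def field_simps)
qed

lemma scalar_prod_self_nonneg: "0 \<le> v \<bullet> (v :: real vec)"
  by (simp add: scalar_prod_def sum_nonneg)

text \<open>With B the inverse of \<Sigma>, \<open>norm_mult_sym_pos_def_le\<close> at B v reads v .
  v \<le> b (v . B v), while b (v . A v) \<le> a b (v . v) < v . v for nonzero v. This keeps the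
  tilted density integrable in the moment generating function.\<close>

lemma inverse_minus_sym_pos_def:
  assumes Sg: "\<Sigma> \<in> sym_pos_def p" and b: "b > 0"
    and bound: "\<And>v. v \<in> carrier_vec p \<Longrightarrow> v \<bullet> (\<Sigma> *\<^sub>v v) \<le> b * (v \<bullet> v)"
    and A: "A \<in> carrier_mat p p" "transpose_mat A = A"
    and abound: "\<And>v. v \<in> carrier_vec p \<Longrightarrow> \<bar>v \<bullet> (A *\<^sub>v v)\<bar> \<le> a * (v \<bullet> v)"
    and ab: "a * b < 1"
  shows "the (mat_inverse \<Sigma>) - A \<in> sym_pos_def p"
proof -
  have c: "\<Sigma> \<in> carrier_mat p p" and sym: "transpose_mat \<Sigma> = \<Sigma>" using Sg by (auto simp: sym_pos_def_def)
  obtain B where B: "the (mat_inverse \<Sigma>) = B" "B \<in> carrier_mat p p" "transpose_mat B = B" "\<Sigma> * B = 1\<^sub>m p"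
    using sym_pos_def_inverse[OF Sg] by metis
  have "v \<bullet> ((B - A) *\<^sub>v v) > 0" if v: "v \<in> carrier_vec p" "v \<noteq> 0\<^sub>v p" for v
  proof -
    have SB: "\<Sigma> *\<^sub>v (B *\<^sub>v v) = v" 
      using assoc_mult_mat_vec[OF c B(2) v(1)] B v by simp
    have "v \<bullet> v \<le> b * ((B *\<^sub>v v) \<bullet> v)"
      using norm_mult_sym_pos_def_le[OF Sg b bound, of "B *\<^sub>v v"] B v SB by simp
    also have "(B *\<^sub>v v) \<bullet> v = v \<bullet> (B *\<^sub>v v)" using B v by (intro comm_scalar_prod[of _ p]) auto
    finally have 1: "v \<bullet> v \<le> b * (v \<bullet> (B *\<^sub>v v))" .
    have "v \<bullet> v \<noteq> 0"
    proof
      assume "v \<bullet> v = 0"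
      then have "\<forall>i\<in>{0..<p}. v $ i * v $ i = 0"
        using v by (subst (asm) scalar_prod_def) (auto simp: sum_nonneg_eq_0_iff)
      with v show False by (auto simp: vec_eq_iff)
    qed
    then have pos: "v \<bullet> v > 0" using scalar_prod_self_nonneg[of v] by simp
    have "b * (v \<bullet> (A *\<^sub>v v)) \<le> b * (a * (v \<bullet> v))"
      using abound[OF v(1)] b by (intro mult_left_mono) auto
    also have "\<dots> = (a * b) * (v \<bullet> v)" by simp
    also have "\<dots> < 1 * (v \<bullet> v)" using ab pos by (intro mult_strict_right_mono) auto
    finally have "b * (v \<bullet> (A *\<^sub>v v)) < b * (v \<bullet> (B *\<^sub>v v))" using 1 by simp
    then have "v \<bullet> (A *\<^sub>v v) < v \<bullet> (B *\<^sub>v v)" using b by simp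
    then show ?thesis
      using A B v by (simp add: minus_mult_distrib_mat_vec[of _ p p] scalar_prod_minus_distrib[of _ p])
  qed
  with A B show ?thesis by (auto simp: sym_pos_def_def transpose_minus)
qed

text \<open>The matrix A \<Sigma> is self-adjoint for the inner product x . \<Sigma> y, because
  \<Sigma> A \<Sigma> is symmetric; hence its eigenvalues are real. For the size, \<alpha> (z .
  \<Sigma> z) is the form of A at \<Sigma> z, at most a |\<Sigma> z|^2 \<le> a b (z . \<Sigma> z) in
  absolute value.\<close>

lemma eigenvalue_mult_sym_pos_def:
  assumes Sg: "\<Sigma> \<in> sym_pos_def p" and b: "b > 0"
    and bound: "\<And>v. v \<in> carrier_vec p \<Longrightarrow> v \<bullet> (\<Sigma> *\<^sub>v v) \<le> b * (v \<bullet> v)"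
    and A: "A \<in> carrier_mat p p" "transpose_mat A = A" and a: "a \<ge> 0"
    and abound: "\<And>v. v \<in> carrier_vec p \<Longrightarrow> \<bar>v \<bullet> (A *\<^sub>v v)\<bar> \<le> a * (v \<bullet> v)"
    and x: "x \<in> carrier_vec p" and y: "y \<in> carrier_vec p" and nz: "x \<noteq> 0\<^sub>v p \<or> y \<noteq> 0\<^sub>v p"
    and Nx: "(A * \<Sigma>) *\<^sub>v x = \<alpha> \<cdot>\<^sub>v x - \<beta> \<cdot>\<^sub>v y"
    and Ny: "(A * \<Sigma>) *\<^sub>v y = \<alpha> \<cdot>\<^sub>v y + \<beta> \<cdot>\<^sub>v x"
  shows "\<beta> = 0 \<and> \<bar>\<alpha>\<bar> \<le> a * b"
proof -
  have c: "\<Sigma> \<in> carrier_mat p p" and sym: "transpose_mat \<Sigma> = \<Sigma>" using Sg by (auto simp: sym_pos_def_def)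
  have posx: "z \<bullet> (\<Sigma> *\<^sub>v z) > 0" if "z \<in> carrier_vec p" "z \<noteq> 0\<^sub>v p" for z
    using Sg that by (auto simp: sym_pos_def_def)
  have nonneg: "z \<bullet> (\<Sigma> *\<^sub>v z) \<ge> 0" if "z \<in> carrier_vec p" for z
    using posx[OF that] c by (cases "z = 0\<^sub>v p") (auto simp: less_imp_le)
  have comm: "(\<Sigma> *\<^sub>v u) \<bullet> w = w \<bullet> (\<Sigma> *\<^sub>v u)" if "u \<in> carrier_vec p" "w \<in> carrier_vec p" for u w
    using c that by (intro comm_scalar_prod[of _ p]) auto
  have e1: "(\<Sigma> *\<^sub>v y) \<bullet> (A *\<^sub>v (\<Sigma> *\<^sub>v x)) = \<alpha> * (x \<bullet> (\<Sigma> *\<^sub>v y)) - \<beta> * (y \<bullet> (\<Sigma> *\<^sub>v y))"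
    unfolding assoc_mult_mat_vec[OF A(1) c x, symmetric] Nx using c x y
    by (simp add: scalar_prod_minus_distrib[of _ p] comm)
  have e2: "(\<Sigma> *\<^sub>v x) \<bullet> (A *\<^sub>v (\<Sigma> *\<^sub>v y)) = \<alpha> * (x \<bullet> (\<Sigma> *\<^sub>v y)) + \<beta> * (x \<bullet> (\<Sigma> *\<^sub>v x))"
    unfolding assoc_mult_mat_vec[OF A(1) c y, symmetric] Ny using c x y
    by (simp add: scalar_prod_add_distrib[of _ p] comm scalar_prod_mult_sym[OF c sym y x])
  have "(\<Sigma> *\<^sub>v y) \<bullet> (A *\<^sub>v (\<Sigma> *\<^sub>v x)) = (\<Sigma> *\<^sub>v x) \<bullet> (A *\<^sub>v (\<Sigma> *\<^sub>v y))"
    using A c x y by (intro scalar_prod_mult_sym[of _ p]) auto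
  \<comment> \<open>Equating \<open>e1\<close> and \<open>e2\<close> cancels the terms in \<alpha>
    and leaves \<beta> times a positive number.\<close>
  then have "\<beta> * (x \<bullet> (\<Sigma> *\<^sub>v x) + y \<bullet> (\<Sigma> *\<^sub>v y)) = 0" using e1 e2 by (simp add: algebra_simps)
  moreover have "x \<bullet> (\<Sigma> *\<^sub>v x) + y \<bullet> (\<Sigma> *\<^sub>v y) > 0"
    using nz posx[OF x] posx[OF y] nonneg[OF x] nonneg[OF y] by linarith
  ultimately have \<beta>: "\<beta> = 0" by simp
  have real: "\<bar>\<alpha>\<bar> \<le> a * b" if z: "z \<in> carrier_vec p" "z \<noteq> 0\<^sub>v p" "(A * \<Sigma>) *\<^sub>v z = \<alpha> \<cdot>\<^sub>v z" for z
  proof -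
    have "(\<Sigma> *\<^sub>v z) \<bullet> (A *\<^sub>v (\<Sigma> *\<^sub>v z)) = \<alpha> * (z \<bullet> (\<Sigma> *\<^sub>v z))"
      unfolding assoc_mult_mat_vec[OF A(1) c z(1), symmetric] z(3) using c z
      by (simp add: comm)
    then have "\<bar>\<alpha>\<bar> * (z \<bullet> (\<Sigma> *\<^sub>v z)) = \<bar>(\<Sigma> *\<^sub>v z) \<bullet> (A *\<^sub>v (\<Sigma> *\<^sub>v z))\<bar>"
      using nonneg[OF z(1)] by (simp add: abs_mult)
    also have "\<dots> \<le> a * ((\<Sigma> *\<^sub>v z) \<bullet> (\<Sigma> *\<^sub>v z))" using c z by (intro abound) auto
    also have "\<dots> \<le> a * (b * (z \<bullet> (\<Sigma> *\<^sub>v z)))"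
      using a norm_mult_sym_pos_def_le[OF Sg b bound z(1)] by (intro mult_left_mono) auto
    finally show ?thesis using posx[OF z(1,2)] by (simp add: mult.assoc[symmetric])
  qed
  have "(A * \<Sigma>) *\<^sub>v x = \<alpha> \<cdot>\<^sub>v x" "(A * \<Sigma>) *\<^sub>v y = \<alpha> \<cdot>\<^sub>v y"
    using Nx Ny x y by (auto simp: \<beta>)
  then show ?thesis using \<beta> nz real x y by blast
qed

text \<open>The trace of M^2 is at most the squared Frobenius norm of M, since 2 x y \<le> x^2 +
  y^2. By symmetry of \<Sigma>, row i of A \<Sigma> is \<Sigma> applied to row i of A, which
  multiplies its squared norm by at most b^2.\<close>

lemma mat_trace_square_le:
  assumes Sg: "\<Sigma> \<in> sym_pos_def p" and b: "b > 0"
    and bound: "\<And>v. v \<in> carrier_vec p \<Longrightarrow> v \<bullet> (\<Sigma> *\<^sub>v v) \<le> b * (v \<bullet> v)"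
    and A: "A \<in> carrier_mat p p"
  shows "mat_trace (A * \<Sigma> * (A * \<Sigma>)) \<le> b\<^sup>2 * (\<Sum>i<p. \<Sum>j<p. (A $$ (i, j))\<^sup>2)"
proof -
  have c: "\<Sigma> \<in> carrier_mat p p" and sym: "transpose_mat \<Sigma> = \<Sigma>" using Sg by (auto simp: sym_pos_def_def)
  define M where "M = A * \<Sigma>"
  have M: "M \<in> carrier_mat p p" using A c by (simp add: M_def)
  have "mat_trace (M * M) = (\<Sum>i<p. \<Sum>j<p. M $$ (i, j) * M $$ (j, i))"
    using M by (auto simp: mat_trace_def scalar_prod_def atLeast0LessThan)
  also have "\<dots> \<le> (\<Sum>i<p. \<Sum>j<p. ((M $$ (i, j))\<^sup>2 + (M $$ (j, i))\<^sup>2) / 2)"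
  proof (intro sum_mono)
    fix i j
    show "M $$ (i, j) * M $$ (j, i) \<le> ((M $$ (i, j))\<^sup>2 + (M $$ (j, i))\<^sup>2) / 2"
      using sum_squares_bound[of "M $$ (i, j)" "M $$ (j, i)"] by simp
  qed
  also have "\<dots> = ((\<Sum>i<p. \<Sum>j<p. (M $$ (i, j))\<^sup>2) + (\<Sum>i<p. \<Sum>j<p. (M $$ (j, i))\<^sup>2)) / 2"
    by (simp add: sum.distrib sum_divide_distrib[symmetric])
  also have "(\<Sum>i<p. \<Sum>j<p. (M $$ (j, i))\<^sup>2) = (\<Sum>i<p. \<Sum>j<p. (M $$ (i, j))\<^sup>2)"
    by (rule sum.swap)
  also have "((\<Sum>i<p. \<Sum>j<p. (M $$ (i, j))\<^sup>2) + (\<Sum>i<p. \<Sum>j<p. (M $$ (i, j))\<^sup>2)) / 2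
     = (\<Sum>i<p. \<Sum>j<p. (M $$ (i, j))\<^sup>2)" by simp
  also have "\<dots> \<le> (\<Sum>i<p. b\<^sup>2 * (\<Sum>j<p. (A $$ (i, j))\<^sup>2))"
  proof (rule sum_mono)
    fix i assume "i \<in> {..<p}"
    then have i: "i < p" by simp
    define r where "r = Matrix.row A i"
    have r: "r \<in> carrier_vec p" using A i by (simp add: r_def)
    have Mr: "M $$ (i, j) = (\<Sigma> *\<^sub>v r) $ j" if "j < p" for j
    proof -
      have "col \<Sigma> j = Matrix.row \<Sigma> j" using sym c that by (metis carrier_matD(1) col_transpose)
      then have "M $$ (i, j) = r \<bullet> Matrix.row \<Sigma> j" using A c i that by (simp add: M_def r_def)
      also have "\<dots> = Matrix.row \<Sigma> j \<bullet> r" using r c that by (intro comm_scalar_prod[of _ p]) auto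
      finally show ?thesis using c that by simp
    qed
    have "(\<Sum>j<p. (M $$ (i, j))\<^sup>2) = (\<Sigma> *\<^sub>v r) \<bullet> (\<Sigma> *\<^sub>v r)"
      using c Mr by (simp add: scalar_prod_def atLeast0LessThan power2_eq_square)
    also have "\<dots> \<le> b * (r \<bullet> (\<Sigma> *\<^sub>v r))" by (rule norm_mult_sym_pos_def_le[OF Sg b bound r])
    also have "\<dots> \<le> b * (b * (r \<bullet> r))" using b bound[OF r] by (intro mult_left_mono) auto
    also have "\<dots> = b\<^sup>2 * (\<Sum>j<p. (A $$ (i, j))\<^sup>2)"
      using A i by (simp add: r_def scalar_prod_def atLeast0LessThan power2_eq_square)
    finally show "(\<Sum>j<p. (M $$ (i, j))\<^sup>2) \<le> b\<^sup>2 * (\<Sum>j<p. (A $$ (i, j))\<^sup>2)" .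
  qed
  finally show ?thesis by (simp add: M_def sum_distrib_left)
qed

text \<open>The moment generating function is an inverse square root of det (1 - C \<Sigma>), and
  \<open>det_one_minus_ge\<close> bounds this determinant from below. The first trace cancels
  against the centring; the second gives the quadratic exponent.\<close>

lemma gaussian_mgf_le:
  assumes Sg: "\<Sigma> \<in> sym_pos_def p" and b: "b > 0"
    and bound: "\<And>v. v \<in> carrier_vec p \<Longrightarrow> v \<bullet> (\<Sigma> *\<^sub>v v) \<le> b * (v \<bullet> v)"
    and A: "A \<in> carrier_mat p p" "transpose_mat A = A" and a: "a > 0"
    and abound: "\<And>v. v \<in> carrier_vec p \<Longrightarrow> \<bar>v \<bullet> (A *\<^sub>v v)\<bar> \<le> a * (v \<bullet> v)"
    and F: "(\<Sum>i<p. \<Sum>j<p. (A $$ (i, j))\<^sup>2) \<le> F"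
    and l: "0 \<le> l" "l \<le> 1 / (4 * a * b)"
  shows "(\<integral>\<^sup>+ x. ennreal (exp (l * (quad_form p A x - mat_trace (A * \<Sigma>)))) \<partial>gaussian p \<Sigma>)
     \<le> ennreal (exp (2 * l\<^sup>2 * b\<^sup>2 * F))"
proof -
  have c: "\<Sigma> \<in> carrier_mat p p" using Sg by (auto simp: sym_pos_def_def)
  \<comment> \<open>The factor 2 offsets the division by 2 in the Gaussian exponent.\<close>
  define C where "C = (2 * l) \<cdot>\<^sub>m A"
  have C: "C \<in> carrier_mat p p" "transpose_mat C = C" using A by (auto simp: C_def mat_eq_iff)
  have Cbound: "\<bar>v \<bullet> (C *\<^sub>v v)\<bar> \<le> (2 * l * a) * (v \<bullet> v)" if v: "v \<in> carrier_vec p" for v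
  proof -
    have "C *\<^sub>v v = (2 * l) \<cdot>\<^sub>v (A *\<^sub>v v)"
      unfolding C_def using A v by (intro eq_vecI) auto
    then have "\<bar>v \<bullet> (C *\<^sub>v v)\<bar> = 2 * l * \<bar>v \<bullet> (A *\<^sub>v v)\<bar>"
      using A v l by (simp add: abs_mult)
    also have "\<dots> \<le> 2 * l * (a * (v \<bullet> v))" using l abound[OF v] by (intro mult_left_mono) auto
    finally show ?thesis by simp
  qed
  \<comment> \<open>The upper bound on \<open>l\<close> is chosen for this: it confines the
    eigenvalues of C \<Sigma> to the interval where \<open>exp_le_one_minus\<close> holds, and it
    leaves the inverse of \<Sigma> minus C positive definite.\<close>
  have la: "2 * l * a * b \<le> 1 / 2" using l(2) a b by (simp add: field_simps)
  have pd: "the (mat_inverse \<Sigma>) - C \<in> sym_pos_def p"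
    using la by (intro inverse_minus_sym_pos_def[OF Sg b bound C Cbound]) auto
  note G = gaussian_nn_integral_exp[OF Sg C(1) pd]
  have tr: "mat_trace (C * \<Sigma>) = 2 * l * mat_trace (A * \<Sigma>)"
    using A c by (simp add: mat_trace_def C_def mult_smult_assoc_mat[of _ p p _ p] sum_distrib_left)
  have "mat_trace (C * \<Sigma> * (C * \<Sigma>)) \<le> b\<^sup>2 * (\<Sum>i<p. \<Sum>j<p. (C $$ (i, j))\<^sup>2)"
    by (rule mat_trace_square_le[OF Sg b bound C(1)])
  also have "(\<Sum>i<p. \<Sum>j<p. (C $$ (i, j))\<^sup>2) = 4 * l\<^sup>2 * (\<Sum>i<p. \<Sum>j<p. (A $$ (i, j))\<^sup>2)"
    using A by (simp add: C_def sum_distrib_left power_mult_distrib)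
  also have "b\<^sup>2 * \<dots> \<le> b\<^sup>2 * (4 * l\<^sup>2 * F)" using F by (intro mult_left_mono) auto
  finally have tr2: "mat_trace (C * \<Sigma> * (C * \<Sigma>)) \<le> 4 * l\<^sup>2 * b\<^sup>2 * F" by (simp add: mult_ac)
  define \<tau> where "\<tau> = l * mat_trace (A * \<Sigma>)"
  define D where "D = Determinant.det (1\<^sub>m p - C * \<Sigma>)"
  have "exp (- mat_trace (C * \<Sigma>) - mat_trace (C * \<Sigma> * (C * \<Sigma>))) \<le> D"
    unfolding D_def
  proof (rule det_one_minus_ge)
    fix \<alpha> \<beta> x y
    assume "x \<in> carrier_vec p" "y \<in> carrier_vec p" "x \<noteq> 0\<^sub>v p \<or> y \<noteq> 0\<^sub>v p"
      "C * \<Sigma> *\<^sub>v x = \<alpha> \<cdot>\<^sub>v x - \<beta> \<cdot>\<^sub>v y" "C * \<Sigma> *\<^sub>v y = \<alpha> \<cdot>\<^sub>v y + \<beta> \<cdot>\<^sub>v x"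
    then have "\<beta> = 0 \<and> \<bar>\<alpha>\<bar> \<le> 2 * l * a * b"
      using l a by (intro eigenvalue_mult_sym_pos_def[OF Sg b bound C _ Cbound]) auto
    with la show "\<beta> = 0 \<and> \<bar>\<alpha>\<bar> \<le> 1 / 2" by simp
  qed (use C c in auto)
  moreover have "exp (- 2 * \<tau> - 4 * l\<^sup>2 * b\<^sup>2 * F) \<le> exp (- mat_trace (C * \<Sigma>) - mat_trace (C * \<Sigma> * (C * \<Sigma>)))"
    using tr tr2 by (simp add: \<tau>_def)
  ultimately have D: "exp (- 2 * \<tau> - 4 * l\<^sup>2 * b\<^sup>2 * F) \<le> D" by (rule order_trans[rotated])
  have "exp (- \<tau> - 2 * l\<^sup>2 * b\<^sup>2 * F) = sqrt (exp (- 2 * \<tau> - 4 * l\<^sup>2 * b\<^sup>2 * F))"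
    by (rule real_sqrt_unique[symmetric]) (simp_all add: exp_double[symmetric] algebra_simps)
  also have "\<dots> \<le> sqrt D" using D by simp
  finally have sD: "exp (- \<tau> - 2 * l\<^sup>2 * b\<^sup>2 * F) \<le> sqrt D" .
  have quad: "quad_form p C x = 2 * l * quad_form p A x" for x
    using A by (simp add: quad_form_def C_def sum_distrib_left mult_ac)
  have "(\<integral>\<^sup>+ x. ennreal (exp (l * (quad_form p A x - mat_trace (A * \<Sigma>)))) \<partial>gaussian p \<Sigma>)
     = (\<integral>\<^sup>+ x. ennreal (exp (- \<tau>)) * ennreal (exp (quad_form p C x / 2)) \<partial>gaussian p \<Sigma>)"
    by (simp add: ennreal_mult[symmetric] exp_add[symmetric] quad \<tau>_def algebra_simps)
  also have "\<dots> = ennreal (exp (- \<tau>)) * (\<integral>\<^sup>+ x. ennreal (exp (quad_form p C x / 2)) \<partial>gaussian p \<Sigma>)"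
    unfolding quad_form_def by (rule nn_integral_cmult) measurable
  also have "\<dots> = ennreal (exp (- \<tau>) * (1 / sqrt D))"
    unfolding G(2) D_def[symmetric] using G(1) by (intro ennreal_mult[symmetric]) (auto simp: D_def)
  also have "\<dots> \<le> ennreal (exp (2 * l\<^sup>2 * b\<^sup>2 * F))"
  proof (rule ennreal_leI)
    have "exp (- \<tau>) = exp (2 * l\<^sup>2 * b\<^sup>2 * F) * exp (- \<tau> - 2 * l\<^sup>2 * b\<^sup>2 * F)"
      by (simp add: exp_add[symmetric])
    also have "\<dots> \<le> exp (2 * l\<^sup>2 * b\<^sup>2 * F) * sqrt D" using sD by (intro mult_left_mono) auto
    finally show "exp (- \<tau>) * (1 / sqrt D) \<le> exp (2 * l\<^sup>2 * b\<^sup>2 * F)"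
      using G(1) by (simp add: D_def field_simps)
  qed
  finally show ?thesis .
qed

section \<open>Tail bounds for averages over a sample\<close>

lemma measurable_quad_form_gaussian [measurable]:
  "quad_form p A \<in> borel_measurable (gaussian p \<Sigma>)"
  unfolding quad_form_def by measurable

lemma measurable_sample_quad_form:
  "(\<lambda>X. (1 / real n) * (\<Sum>k<n. quad_form p A (X k)) - c) \<in> borel_measurable (sample_law n p \<Sigma>)"
  unfolding sample_law_def by measurable

lemma prob_space_sample_law:
  assumes "\<Sigma> \<in> sym_pos_def p"
  shows "prob_space (sample_law n p \<Sigma>)"
  unfolding sample_law_def by (intro prob_space_PiM prob_space_gaussian assms)

text \<open>On the event the exponential of l times the centred sum is at least exp (n l t), which
  dominates the indicator. By independence the integral of that exponential factorises into n equal
  moment generating functions.\<close>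

lemma sample_quad_form_chernoff:
  assumes Sg: "\<Sigma> \<in> sym_pos_def p" and n: "n \<ge> 1" and l: "l \<ge> 0"
    and mgf: "(\<integral>\<^sup>+ x. ennreal (exp (l * (quad_form p A x - c))) \<partial>gaussian p \<Sigma>) \<le> ennreal (exp r)"
  shows "measure (sample_law n p \<Sigma>)
      {X \<in> space (sample_law n p \<Sigma>). (1 / real n) * (\<Sum>k<n. quad_form p A (X k)) - c \<ge> t}
    \<le> exp (- real n * (l * t - r))"
proof -
  let ?M = "sample_law n p \<Sigma>"
  define E where "E = {X \<in> space ?M. (1 / real n) * (\<Sum>k<n. quad_form p A (X k)) - c \<ge> t}"
  interpret prob_space ?M by (rule prob_space_sample_law[OF Sg])
  interpret product_sigma_finite "\<lambda>_::nat. gaussian p \<Sigma>"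
    by (intro product_sigma_finite.intro prob_space_imp_sigma_finite prob_space_gaussian Sg)
  have E: "E \<in> sets ?M"
    using borel_measurable_le[OF borel_measurable_const[of t] measurable_sample_quad_form[of n p A c]]
    unfolding E_def by simp
  have "emeasure ?M E = (\<integral>\<^sup>+ X. indicator E X \<partial>?M)" using E by simp
  also have "\<dots> \<le> (\<integral>\<^sup>+ X. ennreal (exp (- real n * l * t)) * (\<Prod>k<n. ennreal (exp (l * (quad_form p A (X k) - c)))) \<partial>?M)"
  proof (rule nn_integral_mono)
    fix X
    show "indicator E X \<le> ennreal (exp (- real n * l * t)) * (\<Prod>k<n. ennreal (exp (l * (quad_form p A (X k) - c))))"
    proof (cases "X \<in> E")
      case True
      then have "(1 / real n) * (\<Sum>k<n. quad_form p A (X k)) - c \<ge> t" by (simp add: E_def)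
      then have "real n * ((1 / real n) * (\<Sum>k<n. quad_form p A (X k)) - c) \<ge> real n * t"
        by (intro mult_left_mono) auto
      then have "(\<Sum>k<n. quad_form p A (X k) - c) \<ge> real n * t"
        using n by (simp add: sum_subtractf algebra_simps)
      then have "l * (\<Sum>k<n. quad_form p A (X k) - c) \<ge> l * (real n * t)"
        using l by (rule mult_left_mono)
      then have "1 \<le> exp (- real n * l * t + (\<Sum>k<n. l * (quad_form p A (X k) - c)))"
        by (simp add: sum_distrib_left mult_ac)
      also have "\<dots> = exp (- real n * l * t) * (\<Prod>k<n. exp (l * (quad_form p A (X k) - c)))"
        by (simp add: exp_add exp_sum exp_diff exp_minus field_simps)
      finally have "ennreal 1 \<le> ennreal \<dots>" by (rule ennreal_leI)
      then show ?thesis using True by (simp add: ennreal_mult prod_ennreal prod_nonneg)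
    qed simp
  qed
  also have "\<dots> = ennreal (exp (- real n * l * t)) * (\<integral>\<^sup>+ X. (\<Prod>k<n. ennreal (exp (l * (quad_form p A (X k) - c)))) \<partial>?M)"
    unfolding sample_law_def
    by (rule nn_integral_cmult) measurable
  also have "(\<integral>\<^sup>+ X. (\<Prod>k<n. ennreal (exp (l * (quad_form p A (X k) - c)))) \<partial>?M)
     = (\<Prod>k<n. \<integral>\<^sup>+ x. ennreal (exp (l * (quad_form p A x - c))) \<partial>gaussian p \<Sigma>)"
    unfolding sample_law_def by (rule product_nn_integral_prod) auto
  also have "\<dots> \<le> (\<Prod>k<n. ennreal (exp r))" using mgf by (intro prod_mono_ennreal) auto
  also have "\<dots> = ennreal (exp (real n * r))"
    by (simp add: ennreal_power exp_of_nat_mult)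
  finally have "emeasure ?M E \<le> ennreal (exp (- real n * l * t)) * ennreal (exp (real n * r))"
    by (simp add: mult_left_mono)
  also have "\<dots> = ennreal (exp (- real n * (l * t - r)))"
    by (simp add: ennreal_mult[symmetric] exp_add[symmetric] algebra_simps)
  finally have "measure ?M E \<le> exp (- real n * (l * t - r))"
    unfolding measure_def by (metis enn2real_leI exp_ge_zero)
  then show ?thesis unfolding E_def .
qed

text \<open>With F = a / 2 the Chernoff exponent per observation is l t - a b^2 l^2, to be made
  large for 0 \<le> l \<le> 1 / (4 a b). The two entries of the maximum in \<open>t\<close> serve
  the cases of an interior and a boundary choice of l.\<close>

lemma sample_quad_form_tail:
  assumes Sg: "\<Sigma> \<in> sym_pos_def p" and b: "b > 0"
    and bound: "\<And>v. v \<in> carrier_vec p \<Longrightarrow> v \<bullet> (\<Sigma> *\<^sub>v v) \<le> b * (v \<bullet> v)"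
    and A: "A \<in> carrier_mat p p" "transpose_mat A = A" and a: "a > 0"
    and abound: "\<And>v. v \<in> carrier_vec p \<Longrightarrow> \<bar>v \<bullet> (A *\<^sub>v v)\<bar> \<le> a * (v \<bullet> v)"
    and F: "(\<Sum>i<p. \<Sum>j<p. (A $$ (i, j))\<^sup>2) \<le> a / 2"
    and n: "n \<ge> 1" and w: "w \<ge> 0"
    and t: "t \<ge> b * max (sqrt (4 * a * w / real n)) (8 * a * w / real n)"
  shows "measure (sample_law n p \<Sigma>) {X \<in> space (sample_law n p \<Sigma>).
      (1 / real n) * (\<Sum>k<n. quad_form p A (X k)) - mat_trace (A * \<Sigma>) \<ge> t} \<le> exp (- w)"
proof -
  have chernoff: "measure (sample_law n p \<Sigma>) {X \<in> space (sample_law n p \<Sigma>).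
      (1 / real n) * (\<Sum>k<n. quad_form p A (X k)) - mat_trace (A * \<Sigma>) \<ge> t} \<le> exp (- w)"
    if l: "0 \<le> l" "l \<le> 1 / (4 * a * b)" and lw: "w \<le> real n * (l * t - 2 * l\<^sup>2 * b\<^sup>2 * (a / 2))" for l
  proof -
    note sample_quad_form_chernoff[OF Sg n l(1) gaussian_mgf_le[OF Sg b bound A a abound F l], of t]
    also have "exp (- real n * (l * t - 2 * l\<^sup>2 * b\<^sup>2 * (a / 2))) \<le> exp (- w)"
      using lw by (simp add: algebra_simps)
    finally show ?thesis .
  qed
  have "b * sqrt (4 * a * w / real n) \<le> b * max (sqrt (4 * a * w / real n)) (8 * a * w / real n)"
    using b by (intro mult_left_mono) auto
  then have t1: "b * sqrt (4 * a * w / real n) \<le> t" using t by linarith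
  have "b * (8 * a * w / real n) \<le> b * max (sqrt (4 * a * w / real n)) (8 * a * w / real n)"
    using b by (intro mult_left_mono) auto
  then have t2: "b * (8 * a * w / real n) \<le> t" using t by linarith
  have t0: "t \<ge> 0" using t1 b a w by (smt (verit) divide_nonneg_nonneg mult_nonneg_nonneg of_nat_0_le_iff real_sqrt_ge_zero)
  show ?thesis
  proof (cases "t \<le> b / 2")
    case True
    \<comment> \<open>The unconstrained maximiser, admissible exactly because t \<le> b / 2. Its
      exponent t^2 / (4 a b^2) is matched by the square-root entry of the maximum.\<close>
    define l where "l = t / (2 * a * b\<^sup>2)"
    have "l \<le> (b / 2) / (2 * a * b\<^sup>2)" unfolding l_def using True a by (intro divide_right_mono) auto
    also have "\<dots> = 1 / (4 * a * b)" using a b by (simp add: field_simps power2_eq_square)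
    finally have l: "0 \<le> l" "l \<le> 1 / (4 * a * b)" using t0 a by (auto simp: l_def)
    have "(b * sqrt (4 * a * w / real n))\<^sup>2 \<le> t\<^sup>2"
      using t1 b a w by (intro power_mono) auto
    then have "b\<^sup>2 * (4 * a * w) \<le> real n * t\<^sup>2"
      using a w n by (simp add: power_mult_distrib field_simps)
    then have "w \<le> real n * (t\<^sup>2 / (4 * a * b\<^sup>2))"
      using a b by (simp add: field_simps)
    also have "t\<^sup>2 / (4 * a * b\<^sup>2) = l * t - 2 * l\<^sup>2 * b\<^sup>2 * (a / 2)"
      using a b by (simp add: l_def field_simps power2_eq_square)
    finally show ?thesis by (rule chernoff[OF l])
  next
    case False
    \<comment> \<open>The largest admissible value. Here t > b / 2 makes the quadratic loss at most
      half of the gain l t, so t / (8 a b) remains, matched by the linear entry of the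
      maximum.\<close>
    define l where "l = 1 / (4 * a * b)"
    have l: "0 \<le> l" "l \<le> 1 / (4 * a * b)" using a b by (auto simp: l_def)
    have "w \<le> real n * (t / (8 * a * b))"
      using t2 a b n by (simp add: field_simps)
    also have "\<dots> \<le> real n * (l * t - 2 * l\<^sup>2 * b\<^sup>2 * (a / 2))"
    proof (rule mult_left_mono)
      have "2 * l\<^sup>2 * b\<^sup>2 * (a / 2) = (b / 2) / (8 * a * b)"
        using a b by (simp add: l_def field_simps power2_eq_square)
      also have "\<dots> \<le> t / (8 * a * b)" using False a b by (intro divide_right_mono) auto
      finally show "t / (8 * a * b) \<le> l * t - 2 * l\<^sup>2 * b\<^sup>2 * (a / 2)"
        using a b by (simp add: l_def field_simps)
    qed simp
    finally show ?thesis by (rule chernoff[OF l])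
  qed
qed

subsection \<open>Lag matrices and Toeplitz matrices\<close>

text \<open>Bound each product v_i v_j by half the sum of squares; by symmetry both halves are
  weighted by the same absolute row sums. This replaces an operator norm estimate.\<close>

lemma quad_form_le_row_sum:
  fixes A :: "real mat"
  assumes A: "A \<in> carrier_mat p p" "transpose_mat A = A"
    and row: "\<And>i. i < p \<Longrightarrow> (\<Sum>j<p. \<bar>A $$ (i, j)\<bar>) \<le> a"
    and v: "v \<in> carrier_vec p"
  shows "\<bar>v \<bullet> (A *\<^sub>v v)\<bar> \<le> a * (v \<bullet> v)"
proof -
  have sym: "A $$ (i, j) = A $$ (j, i)" if "i < p" "j < p" for i j
    using A that by (metis carrier_matD index_transpose_mat(1))
  have "v \<bullet> (A *\<^sub>v v) = (\<Sum>i<p. \<Sum>j<p. A $$ (i, j) * (v $ i * v $ j))"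
    using A v by (auto simp: scalar_prod_def atLeast0LessThan sum_distrib_left mult_ac intro!: sum.cong)
  also have "\<bar>\<dots>\<bar> \<le> (\<Sum>i<p. \<Sum>j<p. \<bar>A $$ (i, j)\<bar> * (((v $ i)\<^sup>2 + (v $ j)\<^sup>2) / 2))"
  proof (rule order_trans[OF sum_abs], rule sum_mono, rule order_trans[OF sum_abs], rule sum_mono)
    fix i j
    have "\<bar>v $ i * v $ j\<bar> \<le> ((v $ i)\<^sup>2 + (v $ j)\<^sup>2) / 2"
      using sum_squares_bound[of "\<bar>v $ i\<bar>" "\<bar>v $ j\<bar>"] by (simp add: abs_mult)
    then show "\<bar>A $$ (i, j) * (v $ i * v $ j)\<bar> \<le> \<bar>A $$ (i, j)\<bar> * (((v $ i)\<^sup>2 + (v $ j)\<^sup>2) / 2)"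
      unfolding abs_mult[of "A $$ (i, j)"] by (rule mult_left_mono) simp
  qed
  also have "\<dots> = ((\<Sum>i<p. \<Sum>j<p. \<bar>A $$ (i, j)\<bar> * (v $ i)\<^sup>2) + (\<Sum>i<p. \<Sum>j<p. \<bar>A $$ (i, j)\<bar> * (v $ j)\<^sup>2)) / 2"
    by (simp add: distrib_left add_divide_distrib sum.distrib sum_divide_distrib)
  also have "(\<Sum>i<p. \<Sum>j<p. \<bar>A $$ (i, j)\<bar> * (v $ j)\<^sup>2) = (\<Sum>i<p. \<Sum>j<p. \<bar>A $$ (i, j)\<bar> * (v $ i)\<^sup>2)"
    using sym by (subst sum.swap) (auto intro!: sum.cong)
  also have "((\<Sum>i<p. \<Sum>j<p. \<bar>A $$ (i, j)\<bar> * (v $ i)\<^sup>2) + (\<Sum>i<p. \<Sum>j<p. \<bar>A $$ (i, j)\<bar> * (v $ i)\<^sup>2)) / 2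
     = (\<Sum>i<p. (\<Sum>j<p. \<bar>A $$ (i, j)\<bar>) * (v $ i)\<^sup>2)" by (simp add: sum_distrib_right)
  also have "\<dots> \<le> (\<Sum>i<p. a * (v $ i)\<^sup>2)"
    using row by (intro sum_mono mult_right_mono) auto
  also have "\<dots> = a * (v \<bullet> v)"
    using v by (simp add: scalar_prod_def atLeast0LessThan sum_distrib_left power2_eq_square)
  finally show ?thesis .
qed

section \<open>Counting matrix positions with a given lag\<close>

definition lag :: "nat \<Rightarrow> nat \<Rightarrow> nat" where
  "lag k l = nat \<bar>int k - int l\<bar>"

lemma lag_commute: "lag k l = lag l k"
  by (simp add: lag_def abs_minus_commute)

lemma lag_eq_iff: "lag k l = j \<longleftrightarrow> l = k + j \<or> k = l + j"
  by (auto simp: lag_def)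

text \<open>In row k the lag j can occur only in the columns k + j and k - j.\<close>

lemma sum_lag_row_le:
  fixes g :: "nat \<Rightarrow> real"
  assumes J: "finite J" and g: "\<And>j. j \<in> J \<Longrightarrow> g j \<ge> 0"
  shows "(\<Sum>l<p. if lag k l \<in> J then g (lag k l) else 0) \<le> (\<Sum>j\<in>J. 2 * g j)"
proof -
  have "(\<Sum>l<p. if lag k l \<in> J then g (lag k l) else 0) = (\<Sum>l<p. \<Sum>j\<in>J. if lag k l = j then g j else 0)"
    using J by (simp add: sum.delta')
  also have "\<dots> = (\<Sum>j\<in>J. \<Sum>l<p. if lag k l = j then g j else 0)" by (rule sum.swap)
  also have "\<dots> \<le> (\<Sum>j\<in>J. 2 * g j)"
  proof (rule sum_mono)
    fix j assume j: "j \<in> J"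
    have "card {l \<in> {..<p}. lag k l = j} \<le> card {k + j, k - j}"
      by (intro card_mono) (auto simp: lag_eq_iff)
    also have "\<dots> \<le> 2" by (simp add: card_insert_if)
    finally have "real (card {l \<in> {..<p}. lag k l = j}) * g j \<le> 2 * g j"
      using g[OF j] by (intro mult_right_mono) auto
    then show "(\<Sum>l<p. if lag k l = j then g j else 0) \<le> 2 * g j"
      by (simp add: sum.If_cases Int_def)
  qed
  finally show ?thesis .
qed

text \<open>A lag j \<ge> 1 occurs at p - j positions above the diagonal and at as many below
  it.\<close>

lemma sum_lag:
  fixes g :: "nat \<Rightarrow> real"
  assumes J: "J \<subseteq> {1..<p}"
  shows "(\<Sum>k<p. \<Sum>l<p. if lag k l \<in> J then g (lag k l) else 0) = (\<Sum>j\<in>J. 2 * (real p - real j) * g j)"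
proof -
  have fin: "finite J" using J finite_subset by blast
  have "(\<Sum>k<p. \<Sum>l<p. if lag k l \<in> J then g (lag k l) else 0)
      = (\<Sum>k<p. \<Sum>l<p. \<Sum>j\<in>J. if lag k l = j then g j else 0)"
    using fin by (simp add: sum.delta')
  also have "\<dots> = (\<Sum>j\<in>J. \<Sum>k<p. \<Sum>l<p. if lag k l = j then g j else 0)"
    by (subst (2) sum.swap, subst sum.swap) simp
  also have "\<dots> = (\<Sum>j\<in>J. 2 * (real p - real j) * g j)"
  proof (rule sum.cong[OF refl])
    fix j assume "j \<in> J"
    then have j: "1 \<le> j" "j < p" using J by auto
    have "(\<Sum>l<p. if lag k l = j then g j else 0)
       = (if k < p - j then g j else 0) + (if j \<le> k then g j else 0)" if k: "k < p" for k
    proof -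
      \<comment> \<open>The test j \<le> k guards against truncated subtraction, and j \<ge> 1 keeps
        the two columns distinct.\<close>
      have "(\<Sum>l<p. if lag k l = j then g j else 0)
        = (\<Sum>l<p. (if l = k + j then g j else 0) + (if l = k - j then (if j \<le> k then g j else 0) else 0))"
        using j by (intro sum.cong) (auto simp: lag_eq_iff)
      also have "\<dots> = (if k < p - j then g j else 0) + (if j \<le> k then g j else 0)"
        unfolding sum.distrib using k j by (subst (1 2) sum.delta) auto
      finally show ?thesis .
    qed
    then have "(\<Sum>k<p. \<Sum>l<p. if lag k l = j then g j else 0)
      = (\<Sum>k<p. if k < p - j then g j else 0) + (\<Sum>k<p. if j \<le> k then g j else 0)"
      by (simp add: sum.distrib)
    also have "(\<Sum>k<p. if k < p - j then g j else 0) = (\<Sum>k\<in>{..<p - j}. g j)"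
      by (rule sum.mono_neutral_cong_right) auto
    also have "(\<Sum>k<p. if j \<le> k then g j else 0) = (\<Sum>k\<in>{j..<p}. g j)"
      by (rule sum.mono_neutral_cong_right) auto
    also have "(\<Sum>k\<in>{..<p - j}. g j) + (\<Sum>k\<in>{j..<p}. g j) = 2 * (real p - real j) * g j"
      using j by (simp add: of_nat_diff algebra_simps)
    finally show "(\<Sum>k<p. \<Sum>l<p. if lag k l = j then g j else 0) = 2 * (real p - real j) * g j" .
  qed
  finally show ?thesis .
qed

section \<open>Size of the matrix of a support\<close>

lemma lag_set_mat_carrier: "lag_set_mat p J \<in> carrier_mat p p"
  by (simp add: lag_set_mat_def)

lemma lag_set_mat_entry:
  assumes "finite J" "k < p" "l < p"
  shows "lag_set_mat p J $$ (k, l) = (if lag k l \<in> J then 1 / (2 * (real p - real (lag k l))) else 0)"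
proof -
  have "\<bar>int k - int l\<bar> = int j \<longleftrightarrow> j = lag k l" for j by (auto simp: lag_def)
  then have "lag_set_mat p J $$ (k, l) = (\<Sum>j\<in>J. if j = lag k l then 1 / (2 * (real p - real j)) else 0)"
    using assms by (simp add: lag_set_mat_def lag_mat_def)
  then show ?thesis using assms by (simp add: sum.delta)
qed

lemma transpose_lag_set_mat:
  assumes "finite J"
  shows "transpose_mat (lag_set_mat p J) = lag_set_mat p J"
  using lag_set_mat_carrier[of p J] assms
  by (intro eq_matI) (auto simp: lag_set_mat_entry lag_commute)

lemma supportsD:
  assumes "J \<in> supports s S" "2 * S < p"
  shows "finite J" "card J = s" "J \<subseteq> {1..<p}" "\<And>j. j \<in> J \<Longrightarrow> j \<le> S"
  using assms finite_subset[of J "{1..S}"] by (auto simp: supports_def)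

text \<open>Each of the s lags j contributes at most two entries 1 / (2 (p - j)), and j \<le> S.
  Through \<open>quad_form_le_row_sum\<close> this supplies the constant \<open>a\<close> of the
  tail bound.\<close>

lemma lag_set_mat_row_sum:
  assumes J: "J \<in> supports s S" and S: "2 * S < p" and k: "k < p"
  shows "(\<Sum>l<p. \<bar>lag_set_mat p J $$ (k, l)\<bar>) \<le> real s / (real p - real S)"
proof -
  note sD = supportsD[OF J S]
  have "(\<Sum>l<p. \<bar>lag_set_mat p J $$ (k, l)\<bar>)
      = (\<Sum>l<p. if lag k l \<in> J then (\<lambda>j. 1 / (2 * (real p - real j))) (lag k l) else 0)"
    using sD k S by (intro sum.cong) (fastforce simp: lag_set_mat_entry)+
  also have "\<dots> \<le> (\<Sum>j\<in>J. 2 * (1 / (2 * (real p - real j))))"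
    using sD S by (intro sum_lag_row_le) fastforce+
  also have "\<dots> \<le> (\<Sum>j\<in>J. 1 / (real p - real S))"
  proof (rule sum_mono)
    fix j assume "j \<in> J"
    then have "real j \<le> real S" "real S < real p" using sD(4) S by auto
    then show "2 * (1 / (2 * (real p - real j))) \<le> 1 / (real p - real S)" by (simp add: divide_simps)
  qed
  also have "\<dots> = real s / (real p - real S)" using sD(2) by simp
  finally show ?thesis .
qed

text \<open>The 2 (p - j) entries of lag j have squares adding up to 1 / (2 (p - j)), half of the
  row sum contribution; hence the hypothesis with a / 2 in
  \<open>sample_quad_form_tail\<close>.\<close>

lemma lag_set_mat_frobenius:
  assumes J: "J \<in> supports s S" and S: "2 * S < p"
  shows "(\<Sum>k<p. \<Sum>l<p. (lag_set_mat p J $$ (k, l))\<^sup>2) \<le> real s / (real p - real S) / 2"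
proof -
  note sD = supportsD[OF J S]
  have "(\<Sum>k<p. \<Sum>l<p. (lag_set_mat p J $$ (k, l))\<^sup>2)
      = (\<Sum>k<p. \<Sum>l<p. if lag k l \<in> J then (\<lambda>j. (1 / (2 * (real p - real j)))\<^sup>2) (lag k l) else 0)"
    using sD by (intro sum.cong) (auto simp: lag_set_mat_entry)
  also have "\<dots> = (\<Sum>j\<in>J. 2 * (real p - real j) * (1 / (2 * (real p - real j)))\<^sup>2)"
    by (rule sum_lag[OF sD(3)])
  also have "\<dots> \<le> (\<Sum>j\<in>J. 1 / (real p - real S) / 2)"
  proof (rule sum_mono)
    fix j assume "j \<in> J"
    then have j: "real j \<le> real S" "real S < real p" using sD(4) S by auto
    then have "2 * (real p - real j) * (1 / (2 * (real p - real j)))\<^sup>2 = 1 / (real p - real j) / 2"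
      by (simp add: power2_eq_square divide_simps)
    also have "\<dots> \<le> 1 / (real p - real S) / 2" using j by (simp add: frac_le)
    finally show "2 * (real p - real j) * (1 / (2 * (real p - real j)))\<^sup>2 \<le> 1 / (real p - real S) / 2" .
  qed
  also have "\<dots> = real s / (real p - real S) / 2" using sD(2) by simp
  finally show ?thesis .
qed

section \<open>The statistic and the Toeplitz covariance matrices\<close>

lemma mat_trace_mult:
  assumes "A \<in> carrier_mat p p" "B \<in> carrier_mat p p"
  shows "mat_trace (A * B) = (\<Sum>i<p. \<Sum>j<p. A $$ (i, j) * B $$ (j, i))"
  using assms by (auto simp: mat_trace_def scalar_prod_def atLeast0LessThan)

text \<open>Rewrites the statistic as an average of quadratic forms centred at its mean under the
  identity covariance, the shape treated by \<open>sample_quad_form_tail\<close>.\<close>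

lemma lin_functional_sample_cov:
  assumes A: "A \<in> carrier_mat p p"
  shows "lin_functional A (sample_cov n p X - 1\<^sub>m p)
     = (1 / real n) * (\<Sum>k<n. quad_form p A (X k)) - mat_trace (A * 1\<^sub>m p)"
proof -
  have "mat_trace (A * (sample_cov n p X - 1\<^sub>m p)) = mat_trace (A * sample_cov n p X) - mat_trace (A * 1\<^sub>m p)"
    using A by (subst (1 2 3) mat_trace_mult[of _ p])
      (auto simp: sample_cov_def sum_subtractf[symmetric] right_diff_distrib intro!: sum.cong)
  also have "mat_trace (A * sample_cov n p X)
     = (\<Sum>i<p. \<Sum>j<p. \<Sum>k<n. (1 / real n) * (A $$ (i, j) * X k i * X k j))"
    using A by (subst mat_trace_mult[of _ p])
      (auto simp: sample_cov_def sum_distrib_left mult_ac intro!: sum.cong)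
  also have "\<dots> = (\<Sum>k<n. \<Sum>i<p. \<Sum>j<p. (1 / real n) * (A $$ (i, j) * X k i * X k j))"
    by (subst (2) sum.swap, subst sum.swap) simp
  also have "\<dots> = (1 / real n) * (\<Sum>k<n. quad_form p A (X k))"
    by (simp add: quad_form_def sum_distrib_left)
  finally show ?thesis by (simp add: lin_functional_def)
qed

lemma sym_toeplitz_entry:
  assumes "\<Sigma> \<in> sym_pos_def p \<inter> toeplitz p" "k < p" "l < p"
  shows "\<Sigma> $$ (k, l) = toeplitz_coeff \<Sigma> (lag k l)"
proof -
  have c: "\<Sigma> \<in> carrier_mat p p" and sym: "\<And>i j. i < p \<Longrightarrow> j < p \<Longrightarrow> \<Sigma> $$ (i, j) = \<Sigma> $$ (j, i)"
    and toep: "\<And>i j. Suc i < p \<Longrightarrow> Suc j < p \<Longrightarrow> \<Sigma> $$ (Suc i, Suc j) = \<Sigma> $$ (i, j)"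
    using IntD1[OF assms(1)] IntD2[OF assms(1)] unfolding sym_pos_def_quad_form toeplitz_def by auto
  have shift: "\<Sigma> $$ (k, k + j) = \<Sigma> $$ (0, j)" if "k + j < p" for k j
    using that by (induction k) (auto simp: toep)
  show ?thesis
  proof (cases "k \<le> l")
    case True
    then show ?thesis using shift[of k "l - k"] assms(3) by (simp add: toeplitz_coeff_def lag_def nat_diff_distrib)
  next
    case False
    then have "nat \<bar>int k - int l\<bar> = k - l" by simp
    then show ?thesis using shift[of l "k - l"] False assms(2,3) sym[of k l]
      by (simp add: toeplitz_coeff_def lag_def)
  qed
qed

text \<open>The form at e_0 + c e_j with c = 1 or c = - 1 equals 2 + 2 c \<sigma>_j, which is
  positive.\<close>

lemma abs_toeplitz_coeff_le_1:
  assumes Sg: "\<Sigma> \<in> sym_pos_def p \<inter> toeplitz p" "toeplitz_coeff \<Sigma> 0 = 1" and j: "1 \<le> j" "j < p"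
  shows "\<bar>toeplitz_coeff \<Sigma> j\<bar> \<le> 1"
proof -
  have pos: "2 + 2 * c * toeplitz_coeff \<Sigma> j > 0" if "c\<^sup>2 = 1" for c :: real
  proof -
    define x where "x = (\<lambda>i. (if i = 0 then 1 else 0) + (if i = j then c else 0 :: real))"
    have "x 0 \<noteq> 0" using j by (simp add: x_def)
    then have "\<exists>i<p. x i \<noteq> 0" using j by (intro exI[of _ 0]) auto
    then have pos: "quad_form p \<Sigma> x > 0" using IntD1[OF Sg(1)] unfolding sym_pos_def_quad_form by blast
    have lin: "(\<Sum>i<p. f i * x i) = f 0 + f j * c" for f
    proof -
      have "(\<Sum>i<p. f i * x i) = (\<Sum>i<p. (if i = 0 then f 0 else 0) + (if i = j then f j * c else 0))"
        using j by (intro sum.cong) (auto simp: x_def)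
      then show ?thesis using j by (simp add: sum.distrib)
    qed
    have "quad_form p \<Sigma> x = (\<Sum>i<p. (\<Sum>k<p. \<Sigma> $$ (i, k) * x k) * x i)"
      by (simp add: quad_form_def sum_distrib_left sum_distrib_right mult_ac)
    also have "\<dots> = (\<Sigma> $$ (0, 0) + \<Sigma> $$ (0, j) * c) + (\<Sigma> $$ (j, 0) + \<Sigma> $$ (j, j) * c) * c"
      by (simp only: lin)
    also have "\<dots> = 2 + 2 * c * toeplitz_coeff \<Sigma> j"
      using sym_toeplitz_entry[OF Sg(1)] Sg(2) j that by (simp add: lag_def power2_eq_square algebra_simps)
    finally show ?thesis using pos by simp
  qed
  from pos[of 1] pos[of "-1"] show ?thesis by simp
qed

text \<open>Row sums again: the diagonal contributes 1, and each of the s lags at most two entries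
  of absolute value at most 1.\<close>

lemma F_plus_quad_bound:
  assumes Sg: "\<Sigma> \<in> sym_pos_def p \<inter> toeplitz p" "toeplitz_coeff \<Sigma> 0 = 1"
    and J: "J \<in> supports s S" and S: "2 * S < p"
    and zero: "\<And>j. j \<in> {1..p - 1} - J \<Longrightarrow> toeplitz_coeff \<Sigma> j = 0"
    and v: "v \<in> carrier_vec p"
  shows "v \<bullet> (\<Sigma> *\<^sub>v v) \<le> (2 * real s + 1) * (v \<bullet> v)"
proof -
  note sD = supportsD[OF J S]
  have "\<bar>v \<bullet> (\<Sigma> *\<^sub>v v)\<bar> \<le> (2 * real s + 1) * (v \<bullet> v)"
  proof (rule quad_form_le_row_sum[OF _ _ _ v])
    fix k assume k: "k < p"
    have "(\<Sum>l<p. \<bar>\<Sigma> $$ (k, l)\<bar>) \<le> (\<Sum>l<p. (if l = k then 1 else 0) + (if lag k l \<in> J then (\<lambda>_. 1) (lag k l) else 0))"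
    proof (rule sum_mono)
      fix l assume "l \<in> {..<p}"
      then have l: "l < p" by simp
      have lag: "lag k l < p" using k l by (auto simp: lag_def)
      show "\<bar>\<Sigma> $$ (k, l)\<bar> \<le> (if l = k then 1 else 0) + (if lag k l \<in> J then (\<lambda>_. 1) (lag k l) else 0)"
      proof (cases "l = k")
        case True
        then show ?thesis using sym_toeplitz_entry[OF Sg(1) k l] Sg(2) by (simp add: lag_def)
      next
        case False
        then have "1 \<le> lag k l" by (auto simp: lag_def)
        then show ?thesis
          using False sym_toeplitz_entry[OF Sg(1) k l] abs_toeplitz_coeff_le_1[OF Sg, of "lag k l"] lag
            zero[of "lag k l"] by auto
      qed
    qed
    also have "\<dots> = 1 + (\<Sum>l<p. if lag k l \<in> J then (\<lambda>_. 1) (lag k l) else 0)"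
      using k by (simp add: sum.distrib)
    also have "\<dots> \<le> 1 + (\<Sum>j\<in>J. 2 * 1)"
      using sD(1) by (intro add_left_mono sum_lag_row_le) auto
    also have "\<dots> = 2 * real s + 1" using sD(2) by simp
    finally show "(\<Sum>l<p. \<bar>\<Sigma> $$ (k, l)\<bar>) \<le> 2 * real s + 1" .
  qed (use Sg(1) in \<open>auto simp: sym_pos_def_def\<close>)
  then show ?thesis by simp
qed

text \<open>The weight 1 / (2 (p - j)) cancels the number of positions with lag j, so each
  coefficient in the support counts once.\<close>

lemma mat_trace_lag_set_mat_toeplitz:
  assumes Sg: "\<Sigma> \<in> sym_pos_def p \<inter> toeplitz p" and J: "J \<in> supports s S" and S: "2 * S < p"
  shows "mat_trace (lag_set_mat p J * \<Sigma>) = (\<Sum>j\<in>J. toeplitz_coeff \<Sigma> j)"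
proof -
  note sD = supportsD[OF J S]
  have c: "\<Sigma> \<in> carrier_mat p p" using Sg by (auto simp: sym_pos_def_def)
  have "mat_trace (lag_set_mat p J * \<Sigma>)
    = (\<Sum>k<p. \<Sum>l<p. if lag k l \<in> J then (\<lambda>j. toeplitz_coeff \<Sigma> j / (2 * (real p - real j))) (lag k l) else 0)"
    unfolding mat_trace_mult[OF lag_set_mat_carrier c]
    using sD(1) by (intro sum.cong) (auto simp: lag_set_mat_entry sym_toeplitz_entry[OF Sg] lag_commute)
  also have "\<dots> = (\<Sum>j\<in>J. 2 * (real p - real j) * (toeplitz_coeff \<Sigma> j / (2 * (real p - real j))))"
    by (rule sum_lag[OF sD(3)])
  also have "\<dots> = (\<Sum>j\<in>J. toeplitz_coeff \<Sigma> j)"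
    using sD(3) by (intro sum.cong) auto
  finally show ?thesis .
qed

lemma mat_trace_lag_set_mat:
  assumes J: "J \<in> supports s S" and S: "2 * S < p"
  shows "mat_trace (lag_set_mat p J * 1\<^sub>m p) = 0"
proof -
  note sD = supportsD[OF J S]
  have "0 \<notin> J" using sD(3) by auto
  then show ?thesis
    using sD(1) lag_set_mat_carrier[of p J] by (simp add: mat_trace_def lag_set_mat_entry lag_def)
qed

lemma one_mat_sym_pos_def: "1\<^sub>m p \<in> sym_pos_def p"
  unfolding sym_pos_def_quad_form
proof (intro conjI allI impI)
  fix x :: "nat \<Rightarrow> real" assume "\<exists>i<p. x i \<noteq> 0"
  then obtain i where i: "i < p" "x i \<noteq> 0" by blast
  have "quad_form p (1\<^sub>m p) x = (\<Sum>i<p. \<Sum>j<p. if j = i then x i * x i else 0)"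
    unfolding quad_form_def by (intro sum.cong) auto
  also have "\<dots> = (\<Sum>i<p. x i * x i)" by simp
  also have "\<dots> > 0" using i by (intro sum_pos2[of _ i]) (auto simp: zero_less_mult_iff linorder_neq_iff)
  finally show "quad_form p (1\<^sub>m p) x > 0" .
qed auto

subsection \<open>The test\<close>

lemma finite_supports: "finite (supports s S)"
  unfolding supports_def by (rule finite_subset[of _ "Pow {1..S}"]) auto

lemma card_supports: "card (supports s S) = S choose s"
  unfolding supports_def by (subst n_subsets) auto

lemma supports_nonempty: "s \<le> S \<Longrightarrow> supports s S \<noteq> {}"
  using card_supports[of s S] by auto

lemma HS_test_eq_1:
  assumes "s \<le> S" "HS_test n p s S u X = 1"
  shows "\<exists>J\<in>supports s S. HS_threshold n p s S u \<le> lin_functional (lag_set_mat p J) (sample_cov n p X - 1\<^sub>m p)"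
proof -
  have "HS_test n p s S u X \<in> (\<lambda>J. of_bool (lin_functional (lag_set_mat p J) (sample_cov n p X - 1\<^sub>m p)
                          \<ge> HS_threshold n p s S u)) ` supports s S"
    unfolding HS_test_def using finite_supports supports_nonempty[OF assms(1)] by (intro Max_in) auto
  then obtain J where J: "J \<in> supports s S"
    and "HS_test n p s S u X = of_bool (lin_functional (lag_set_mat p J) (sample_cov n p X - 1\<^sub>m p)
      \<ge> HS_threshold n p s S u)" by (rule imageE)
  with assms(2) have "lin_functional (lag_set_mat p J) (sample_cov n p X - 1\<^sub>m p) \<ge> HS_threshold n p s S u"
    by (simp only: of_bool_eq_1_iff)
  with J show ?thesis by blast
qed

lemma HS_test_eq_0:
  assumes "HS_test n p s S u X = 0" "J \<in> supports s S"
  shows "lin_functional (lag_set_mat p J) (sample_cov n p X - 1\<^sub>m p) < HS_threshold n p s S u"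
proof -
  have "(of_bool (lin_functional (lag_set_mat p J) (sample_cov n p X - 1\<^sub>m p)
                          \<ge> HS_threshold n p s S u) :: nat) \<le> HS_test n p s S u X"
    unfolding HS_test_def using finite_supports assms(2) by (intro Max_ge) auto
  with assms(1) show ?thesis by (auto split: if_splits)
qed

text \<open>These events enclose the error events of the test; monotonicity of the measure asks for
  measurability of the enclosing set.\<close>

lemma sets_sample_quad_form_ge:
  "{X \<in> space (sample_law n p \<Sigma>). (1 / real n) * (\<Sum>k<n. quad_form p A (X k)) - c \<ge> t} \<in> sets (sample_law n p \<Sigma>)"
  using borel_measurable_le[OF borel_measurable_const[of t] measurable_sample_quad_form[of n p A c]] by simp

text \<open>A union bound over the supports. The tail bound with b = 1 and w = u ln C, where C is
  their number, gives exp (- u ln C) for each.\<close>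

lemma HS_test_type_I:
  assumes "1 \<le> n" "1 \<le> s" "s \<le> S" "2 * S < p" "1 < u"
  shows "measure (sample_law n p (1\<^sub>m p)) {X \<in> space (sample_law n p (1\<^sub>m p)). HS_test n p s S u X = 1}
    \<le> exp (- (u - 1) * ln (real (S choose s)))"
proof -
  let ?M = "sample_law n p (1\<^sub>m p)"
  let ?C = "real (S choose s)"
  define t where "t = HS_threshold n p s S u"
  define a where "a = real s / (real p - real S)"
  define E where "E = (\<lambda>J. {X \<in> space ?M.
    (1 / real n) * (\<Sum>k<n. quad_form p (lag_set_mat p J) (X k)) - mat_trace (lag_set_mat p J * 1\<^sub>m p) \<ge> t})"
  interpret prob_space ?M by (rule prob_space_sample_law[OF one_mat_sym_pos_def])
  have a: "a > 0" using assms by (simp add: a_def)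
  have C: "?C \<ge> 1" using assms(3) by (simp add: Suc_le_eq)
  have E: "E J \<in> events" for J unfolding E_def by (rule sets_sample_quad_form_ge)
  have tail: "prob (E J) \<le> exp (- (u * ln ?C))" if J: "J \<in> supports s S" for J
    unfolding E_def
  proof (rule sample_quad_form_tail[where a = a and b = 1])
    show "t \<ge> 1 * max (sqrt (4 * a * (u * ln ?C) / real n)) (8 * a * (u * ln ?C) / real n)"
      by (simp add: t_def HS_threshold_def a_def mult_ac)
    show "transpose_mat (lag_set_mat p J) = lag_set_mat p J"
      by (rule transpose_lag_set_mat[OF supportsD(1)[OF J assms(4)]])
    fix v :: "real vec" assume v: "v \<in> carrier_vec p"
    show "\<bar>v \<bullet> (lag_set_mat p J *\<^sub>v v)\<bar> \<le> a * (v \<bullet> v)"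
      unfolding a_def using lag_set_mat_row_sum[OF J assms(4)] v
      by (intro quad_form_le_row_sum[where p = p] lag_set_mat_carrier transpose_lag_set_mat supportsD(1)[OF J assms(4)])
    show "v \<bullet> (1\<^sub>m p *\<^sub>v v) \<le> 1 * (v \<bullet> v)" using v by simp
  qed (use a C assms lag_set_mat_frobenius[OF J assms(4)] in
      \<open>auto simp: a_def lag_set_mat_carrier one_mat_sym_pos_def\<close>)
  have "{X \<in> space ?M. HS_test n p s S u X = 1} \<subseteq> (\<Union>J\<in>supports s S. E J)"
    using HS_test_eq_1[OF assms(3), of n p u]
    by (fastforce simp: E_def t_def lin_functional_sample_cov[OF lag_set_mat_carrier])
  then have "prob {X \<in> space ?M. HS_test n p s S u X = 1} \<le> prob (\<Union>J\<in>supports s S. E J)"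
    using E finite_supports by (intro finite_measure_mono) auto
  also have "\<dots> \<le> (\<Sum>J\<in>supports s S. prob (E J))"
    using E finite_supports by (intro finite_measure_subadditive_finite) auto
  also have "\<dots> \<le> ?C * exp (- (u * ln ?C))"
    unfolding card_supports[symmetric] using tail[unfolded card_supports[symmetric]] by (rule sum_bounded_above)
  \<comment> \<open>Writing the number of supports as exp (ln C) turns the factor u into u -
    1.\<close>
  also have "\<dots> = exp (ln ?C) * exp (- (u * ln ?C))" using C by (subst exp_ln) linarith+
  also have "\<dots> = exp (- (u - 1) * ln ?C)" unfolding exp_add[symmetric] by (simp add: algebra_simps)
  finally show ?thesis .
qed

text \<open>If the test accepts, the statistic of the true support is below the threshold, although
  its mean exceeds the threshold by at least b m. The tail bound with b = 2 s + 1 and w = u / 4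
  controls such a deviation.\<close>

lemma HS_test_type_II:
  assumes "1 \<le> n" "1 \<le> s" "2 * S < p" "1 < u"
    and sig: "\<sigma> \<ge> (1 / real s) *
           (HS_threshold n p s S u +
            (2 * real s + 1) *
              max (sqrt (u * real s / (real n * (real p - real S))))
                  (2 * u * real s / (real n * (real p - real S))))"
    and Sg: "\<Sigma> \<in> F_plus p s S \<sigma>"
  shows "measure (sample_law n p \<Sigma>) {X \<in> space (sample_law n p \<Sigma>). HS_test n p s S u X = 0} \<le> exp (- u / 4)"
proof -
  let ?M = "sample_law n p \<Sigma>"
  define t where "t = HS_threshold n p s S u"
  define a where "a = real s / (real p - real S)"
  define b where "b = 2 * real s + 1"
  define m where "m = max (sqrt (u * real s / (real n * (real p - real S)))) (2 * u * real s / (real n * (real p - real S)))"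
  from Sg obtain J where T: "\<Sigma> \<in> sym_pos_def p \<inter> toeplitz p" "toeplitz_coeff \<Sigma> 0 = 1"
    and J: "J \<in> supports s S" and ge: "\<And>j. j \<in> J \<Longrightarrow> toeplitz_coeff \<Sigma> j \<ge> \<sigma>"
    and zero: "\<And>j. j \<in> {1..p - 1} - J \<Longrightarrow> toeplitz_coeff \<Sigma> j = 0"
    unfolding F_plus_def by blast
  have c: "\<Sigma> \<in> carrier_mat p p" and spd: "\<Sigma> \<in> sym_pos_def p" using T by (auto simp: sym_pos_def_def)
  interpret prob_space ?M by (rule prob_space_sample_law[OF spd])
  note sD = supportsD[OF J assms(3)]
  define A where "A = lag_set_mat p J"
  \<comment> \<open>The tail bound concerns upper deviations; the negated matrix turns the lower
    deviation into an upper one.\<close>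
  define B where "B = - A"
  have A: "A \<in> carrier_mat p p" "transpose_mat A = A"
    using lag_set_mat_carrier transpose_lag_set_mat[OF sD(1)] by (auto simp: A_def)
  have B: "B \<in> carrier_mat p p" "transpose_mat B = B" using A by (auto simp: B_def mat_eq_iff)
  have entry: "B $$ (i, j) = - A $$ (i, j)" if "i < p" "j < p" for i j using A that by (simp add: B_def)
  define E where "E = {X \<in> space ?M.
    (1 / real n) * (\<Sum>k<n. quad_form p B (X k)) - mat_trace (B * \<Sigma>) \<ge> b * m}"
  have a: "a > 0" using assms by (simp add: a_def)
  have b: "b > 0" by (simp add: b_def)
  have tail: "prob E \<le> exp (- (u / 4))"
    unfolding E_def
  proof (rule sample_quad_form_tail[OF spd b _ B a])
    have "4 * a * (u / 4) / real n = u * real s / (real n * (real p - real S))"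
      "8 * a * (u / 4) / real n = 2 * u * real s / (real n * (real p - real S))"
      by (simp_all add: a_def field_simps)
    then show "b * m \<ge> b * max (sqrt (4 * a * (u / 4) / real n)) (8 * a * (u / 4) / real n)"
      unfolding m_def by (simp only: order_refl)
    show "(\<Sum>i<p. \<Sum>j<p. (B $$ (i, j))\<^sup>2) \<le> a / 2"
      using lag_set_mat_frobenius[OF J assms(3)] entry by (simp add: a_def A_def)
    fix v :: "real vec" assume v: "v \<in> carrier_vec p"
    show "\<bar>v \<bullet> (B *\<^sub>v v)\<bar> \<le> a * (v \<bullet> v)"
    proof (rule quad_form_le_row_sum[OF B _ v])
      fix k assume "k < p"
      then show "(\<Sum>l<p. \<bar>B $$ (k, l)\<bar>) \<le> a"
        using lag_set_mat_row_sum[OF J assms(3)] entry by (simp add: a_def A_def)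
    qed
    show "v \<bullet> (\<Sigma> *\<^sub>v v) \<le> b * (v \<bullet> v)"
      unfolding b_def by (rule F_plus_quad_bound[OF T J assms(3) zero v])
  qed (use assms in auto)
  have quad: "quad_form p B x = - quad_form p A x" for x
    by (simp add: quad_form_def entry sum_negf)
  have "mat_trace (B * \<Sigma>) = - mat_trace (A * \<Sigma>)"
    using A B c by (simp add: mat_trace_mult[of _ p] entry sum_negf)
  also have "mat_trace (A * \<Sigma>) = (\<Sum>j\<in>J. toeplitz_coeff \<Sigma> j)"
    unfolding A_def by (rule mat_trace_lag_set_mat_toeplitz[OF T(1) J assms(3)])
  finally have trB: "mat_trace (B * \<Sigma>) = - (\<Sum>j\<in>J. toeplitz_coeff \<Sigma> j)" .
  \<comment> \<open>The separation condition multiplied by s: all s coefficients in the support are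
    at least \<sigma>, so the mean of the statistic is at least s \<sigma>.\<close>
  have "t + b * m = real s * ((1 / real s) * (t + b * m))" using assms(2) by simp
  also have "\<dots> \<le> real s * \<sigma>" using sig unfolding t_def b_def m_def by (intro mult_left_mono) auto
  also have "\<dots> = (\<Sum>j\<in>J. \<sigma>)" using sD(2) by simp
  also have "\<dots> \<le> (\<Sum>j\<in>J. toeplitz_coeff \<Sigma> j)" using ge by (rule sum_mono)
  finally have sep: "t + b * m \<le> (\<Sum>j\<in>J. toeplitz_coeff \<Sigma> j)" .
  have "{X \<in> space ?M. HS_test n p s S u X = 0} \<subseteq> E"
  proof safe
    fix X assume X: "X \<in> space ?M" "HS_test n p s S u X = 0"
    have "(1 / real n) * (\<Sum>k<n. quad_form p A (X k)) < t"
      using HS_test_eq_0[OF X(2) J] mat_trace_lag_set_mat[OF J assms(3)]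
      by (simp add: lin_functional_sample_cov[OF lag_set_mat_carrier] A_def t_def)
    with X sep show "X \<in> E" by (simp add: E_def quad trB sum_negf)
  qed
  then have "prob {X \<in> space ?M. HS_test n p s S u X = 0} \<le> prob E"
    unfolding E_def by (intro finite_measure_mono sets_sample_quad_form_ge)
  with tail show ?thesis by simp
qed

theorem theorem3p3:
  fixes n p s S :: nat and u \<sigma> :: real
  assumes "1 \<le> n"
    and "1 \<le> s" and "s \<le> S" and "real S < real p / 2"
    and "1 < u"
    and "0 < \<sigma>"
    and "\<sigma> \<ge> (1 / real s) *
           (HS_threshold n p s S u +
            (2 * real s + 1) *
              max (sqrt (u * real s / (real n * (real p - real S))))
                  (2 * u * real s / (real n * (real p - real S))))"
  shows "risk n p (HS_test n p s S u) (F_plus p s S \<sigma>)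
           \<le> exp (- (u - 1) * ln (real (S choose s))) + exp (- u / 4)"
proof -
  have S: "2 * S < p" using assms(4) by linarith
  \<comment> \<open>An empty class contributes 0 by the convention in \<open>risk\<close>; otherwise
    the uniform bound over the class passes to the supremum.\<close>
  have "(if F_plus p s S \<sigma> = {} then 0 else
        (SUP \<Sigma>\<in>F_plus p s S \<sigma>. measure (sample_law n p \<Sigma>)
          {X \<in> space (sample_law n p \<Sigma>). HS_test n p s S u X = 0})) \<le> exp (- u / 4)"
    using HS_test_type_II[OF assms(1,2) S assms(5,7)] by (auto intro!: cSUP_least)
  then show ?thesis
    unfolding risk_def using HS_test_type_I[OF assms(1-3) S assms(5)] by (rule add_mono[rotated])
qed

end
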